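(* Let $L$ be a Lelek fan and let $Y$ be a non-degenerate continuum. The following are equivalent: 1. there is an embedding $e:Y\to L$ and a retraction $r:L\to e(Y)$ that is a monotone map; 2. there is a monotone surjective map $f:L\to Y$; 3. $Y$ is a Lelek fan.
   Context: A continuum is a nonempty compact connected metric space; it is non-degenerate if it has more than one point. A dendroid is an arcwise connected, hereditarily unicoherent continuum. A point $x$ of a dendroid $X$ is a ramification point if $x$ is the top (the branch point) of some simple triod in $X$. A fan is a dendroid with at most one ramification point; this point, if it exists, is called the top of the fan. For a fan $X$, a point $x$ is an end point of $X$ if $x$ is an end point of every arc in $X$ containing $x$; $E(X)$ denotes the set of end points of $X$. A fan $X$ with top $v$ is smooth if for every $x\in X$ and every sequence $x_n\to x$ in $X$, the arcs from $v$ to $x_n$ converge (in the Hausdorff metric) to the arc from $v$ to $x$. A Lelek fan is a smooth fan $X$ with $\mathrm{Cl}(E(X))=X$. A continuous map $f:X\to Z$ between continua is monotone if $f^{-1}(z)$ is connected for every $z\in f(X)$. A retraction from $X$ onto a subspace $Y$ is a continuous map $r:X\to Y$ with $r(y)=y$ for all $y\in Y$. An embedding is a continuous map that is a homeomorphism onto its image. *)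

theory Defs
  imports "HOL-Analysis.Analysis"
begin

definition continuum :: "'a::metric_space set \<Rightarrow> bool" where
  "continuum X \<longleftrightarrow> X \<noteq> {} \<and> compact X \<and> connected X"

definition nondegenerate :: "'a set \<Rightarrow> bool" where
  "nondegenerate X \<longleftrightarrow> (\<exists>x\<in>X. \<exists>y\<in>X. x \<noteq> y)"

text \<open>An arc in X from x to y (x, y distinct automatically since arc paths are injective).\<close>
definition arc_in :: "'a::metric_space set \<Rightarrow> 'a \<Rightarrow> 'a \<Rightarrow> 'a set \<Rightarrow> bool" where
  "arc_in X x y A \<longleftrightarrow> (\<exists>g. arc g \<and> pathstart g = x \<and> pathfinish g = y \<and> path_image g = A \<and> A \<subseteq> X)"

definition arcwise_connected :: "'a::metric_space set \<Rightarrow> bool" where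
  "arcwise_connected X \<longleftrightarrow> (\<forall>x\<in>X. \<forall>y\<in>X. x \<noteq> y \<longrightarrow> (\<exists>A. arc_in X x y A))"

definition hereditarily_unicoherent :: "'a::metric_space set \<Rightarrow> bool" where
  "hereditarily_unicoherent X \<longleftrightarrow>
     (\<forall>A B. A \<subseteq> X \<and> B \<subseteq> X \<and> continuum A \<and> continuum B \<longrightarrow> connected (A \<inter> B))"

definition dendroid :: "'a::metric_space set \<Rightarrow> bool" where
  "dendroid X \<longleftrightarrow> continuum X \<and> arcwise_connected X \<and> hereditarily_unicoherent X"

definition ramification_point :: "'a::metric_space set \<Rightarrow> 'a \<Rightarrow> bool" where
  "ramification_point X v \<longleftrightarrow> v \<in> X \<and>
     (\<exists>a b c A B C. arc_in X v a A \<and> arc_in X v b B \<and> arc_in X v c C \<and>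
        A \<inter> B = {v} \<and> A \<inter> C = {v} \<and> B \<inter> C = {v})"

definition fan :: "'a::metric_space set \<Rightarrow> bool" where
  "fan X \<longleftrightarrow> dendroid X \<and> (\<forall>u v. ramification_point X u \<and> ramification_point X v \<longrightarrow> u = v)"

definition end_points :: "'a::metric_space set \<Rightarrow> 'a set" where
  "end_points X = {x\<in>X. \<forall>a b A. arc_in X a b A \<and> x \<in> A \<longrightarrow> x = a \<or> x = b}"

text \<open>The arc [v,x] in a dendroid X (degenerate {v} if x = v).\<close>
definition arc_from :: "'a::metric_space set \<Rightarrow> 'a \<Rightarrow> 'a \<Rightarrow> 'a set" where
  "arc_from X v x = (if x = v then {v} else (THE A. arc_in X v x A))"

text \<open>Hausdorff distance between (nonempty bounded) sets.\<close>
definition hausdorff_dist :: "'a::metric_space set \<Rightarrow> 'a set \<Rightarrow> real" where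
  "hausdorff_dist A B = max (SUP a\<in>A. infdist a B) (SUP b\<in>B. infdist b A)"

definition smooth_fan_with_top :: "'a::metric_space set \<Rightarrow> 'a \<Rightarrow> bool" where
  "smooth_fan_with_top X v \<longleftrightarrow> fan X \<and> ramification_point X v \<and>
     (\<forall>x s. x \<in> X \<and> (\<forall>n. s n \<in> X) \<and> s \<longlonglongrightarrow> x \<longrightarrow>
        (\<lambda>n. hausdorff_dist (arc_from X v (s n)) (arc_from X v x)) \<longlonglongrightarrow> 0)"

definition smooth_fan :: "'a::metric_space set \<Rightarrow> bool" where
  "smooth_fan X \<longleftrightarrow> (\<exists>v. smooth_fan_with_top X v)"

definition Lelek_fan :: "'a::metric_space set \<Rightarrow> bool" where
  "Lelek_fan X \<longleftrightarrow> smooth_fan X \<and> closure (end_points X) = X"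

definition monotone_map :: "'a::metric_space set \<Rightarrow> ('a \<Rightarrow> 'b::metric_space) \<Rightarrow> bool" where
  "monotone_map X f \<longleftrightarrow> continuous_on X f \<and> (\<forall>z\<in>f ` X. connected {x\<in>X. f x = z})"

definition embedding_into :: "'b::metric_space set \<Rightarrow> 'a::metric_space set \<Rightarrow> ('b \<Rightarrow> 'a) \<Rightarrow> bool" where
  "embedding_into Y L e \<longleftrightarrow> e ` Y \<subseteq> L \<and> (\<exists>e'. homeomorphism Y (e ` Y) e e')"

end

(*
Three facts give the theorem: the Lelek fan is unique up to homeomorphism, every nondegenerate monotone
image of a Lelek fan is again one, and being a Lelek fan is a topological property; embedding and
retraction can then be taken to be a homeomorphism and the identity.

A smooth fan carries a continuous radial function that vanishes at the top and is strictly increasing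
along each leg (a Whitney function evaluated at the arcs issuing from the top), and countably many sets
clopen off the top that separate the legs. A nondegenerate monotone image of a Lelek fan inherits such
data, with leg tops dense.

Two spaces with such data are homeomorphic by a back-and-forth construction. Refine matched clopen
partitions into unions of legs; density of the tops makes it possible to cut from a piece a part whose
maximal height is close to any prescribed smaller value, so the logarithms of the ratios of the maximal
heights of matched pieces can be changed by at most 2^-n in step n. In the limit each leg of one space is
matched with one leg of the other, and the two are identified by a rescaling of height that depends
continuously on the leg.
*)
theory Submission
  imports Defs
begin

section \<open>Spaces with a radial function and separated legs\<close>

text \<open>A monotone image of \<open>L\<close> is never checked directly to be hereditarily
  unicoherent, to have only one ramification point or to be smooth. It only receives a leg
  structure; this makes it homeomorphic to \<open>L\<close>, and the Lelek property is then
  transported. For this reason the locale speaks of heights and clopen sets and not of arcs, and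
  \<open>L\<close> gets its own structure as the image of its identity map.

  The obstacle is the top: pieces are compact only after cutting off small heights. Ratios of
  heights are controlled instead of differences, because a bounded ratio makes the heights of
  corresponding points tend to 0 together, which gives continuity at the top in both directions.
  Heights of pieces can be prescribed only up to an open interval, so ratios cannot be kept fixed;
  summable changes make them converge along every branch.\<close>

lemma compact_decseq_Inter_nonempty:
  fixes F :: "nat \<Rightarrow> 'a::metric_space set"
  assumes "\<And>n. compact (F n)" "\<And>n. F n \<noteq> {}" "\<And>n. F (Suc n) \<subseteq> F n"
  shows "(\<Inter>n. F n) \<noteq> {}"
proof -
  have anti: "F n \<subseteq> F m" if "m \<le> n" for m n
    using that assms(3) by (rule lift_Suc_antimono_le[rotated])
  have "F 0 \<inter> (\<Inter>n\<in>UNIV. F n) \<noteq> {}"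
  proof (rule compact_imp_fip_image)
    fix I :: "nat set" assume "finite I"
    have "F (Max (insert 0 I)) \<subseteq> F 0 \<inter> (\<Inter>i\<in>I. F i)"
      using anti \<open>finite I\<close> by (simp add: le_INF_iff)
    then show "F 0 \<inter> (\<Inter>i\<in>I. F i) \<noteq> {}"
      using assms(2) by blast
  qed (simp_all add: assms(1) compact_imp_closed)
  then show ?thesis by blast
qed

text \<open>Dependent choice along the full binary tree. Nodes are lists with the latest decision at
  the head, so \<open>True # s\<close> and \<open>False # s\<close> are the children of
  \<open>s\<close>, and \<open>step\<close> receives the level \<open>length s\<close>.\<close>

lemma tree_choice:
  assumes "good t0"
    and "\<And>n t. good t \<Longrightarrow> \<exists>t1 t2. good t1 \<and> good t2 \<and> step n t t1 t2"
  shows "\<exists>T :: bool list \<Rightarrow> 't. T [] = t0 \<and> (\<forall>s. good (T s)) \<and>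
           (\<forall>s. step (length s) (T s) (T (True # s)) (T (False # s)))"
proof -
  have "\<forall>n t. \<exists>p. good t \<longrightarrow> good (fst p) \<and> good (snd p) \<and> step n t (fst p) (snd p)"
    using assms(2) by (metis fst_conv snd_conv)
  then obtain g where g: "\<And>n t. good t \<Longrightarrow> good (fst (g n t)) \<and> good (snd (g n t)) \<and> step n t (fst (g n t)) (snd (g n t))"
    by metis
  define T where "T = rec_list t0 (\<lambda>b s t. if b then fst (g (length s) t) else snd (g (length s) t))"
  have T: "T [] = t0" "T (b # s) = (if b then fst (g (length s) (T s)) else snd (g (length s) (T s)))" for b s
    by (simp_all add: T_def)
  have good: "good (T s)" for s
    by (induction s) (use assms(1) g T in auto)
  show ?thesis
    using T good g by (intro exI[of _ T]) auto
qed

text \<open>A Lelek fan described without arcs, so that the description can be verified on a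
  monotone image. A leg is a class of points with the same membership pattern in the sets
  \<open>U n\<close>; \<open>leg_inj\<close> and \<open>leg_ivt\<close> make \<open>\<rho>\<close> a
  coordinate on it, and \<open>dense_tops\<close> stands for the density of end points.\<close>

locale leg_structure =
  fixes X :: "'a::metric_space set" and v :: 'a and \<rho> :: "'a \<Rightarrow> real" and U :: "nat \<Rightarrow> 'a set"
  assumes compact_X: "compact X" and v_in: "v \<in> X"
    and rho_cont: "continuous_on X \<rho>" and rho_v: "\<rho> v = 0"
    and rho_pos: "\<And>x. x \<in> X - {v} \<Longrightarrow> 0 < \<rho> x"
    and U_open: "\<And>n. openin (top_of_set (X - {v})) (U n)"
    and U_closed: "\<And>n. closedin (top_of_set (X - {v})) (U n)"
    and leg_inj: "\<And>x y. \<lbrakk>x \<in> X - {v}; y \<in> X - {v}; \<forall>n. x \<in> U n \<longleftrightarrow> y \<in> U n; \<rho> x = \<rho> y\<rbrakk> \<Longrightarrow> x = y"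
    and leg_ivt: "\<And>x t. \<lbrakk>x \<in> X - {v}; 0 < t; t \<le> \<rho> x\<rbrakk>
          \<Longrightarrow> \<exists>y \<in> X - {v}. (\<forall>n. y \<in> U n \<longleftrightarrow> x \<in> U n) \<and> \<rho> y = t"
    and dense_tops: "\<And>x \<epsilon>. \<lbrakk>x \<in> X - {v}; 0 < \<epsilon>\<rbrakk> \<Longrightarrow> \<exists>e \<in> X - {v}. dist e x < \<epsilon> \<and>
          (\<forall>y \<in> X - {v}. (\<forall>n. y \<in> U n \<longleftrightarrow> e \<in> U n) \<longrightarrow> \<rho> y \<le> \<rho> e)"
    and nonempty: "X - {v} \<noteq> {}"
begin

definition same_leg :: "'a \<Rightarrow> 'a \<Rightarrow> bool" where
  "same_leg x y \<longleftrightarrow> (\<forall>n. x \<in> U n \<longleftrightarrow> y \<in> U n)"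

definition piece :: "'a set \<Rightarrow> bool" where
  "piece P \<longleftrightarrow> openin (top_of_set (X - {v})) P \<and> closedin (top_of_set (X - {v})) P \<and>
     (\<forall>x\<in>P. \<forall>y\<in>X - {v}. same_leg x y \<longrightarrow> y \<in> P)"

definition height :: "'a set \<Rightarrow> real" where
  "height P = Sup (\<rho> ` P)"

lemma piece_subset: "piece P \<Longrightarrow> P \<subseteq> X - {v}"
  unfolding piece_def using openin_imp_subset by blast

lemma piece_U: "piece (U n)"
  using U_open U_closed by (auto simp: piece_def same_leg_def)

lemma piece_Int: "piece P \<Longrightarrow> piece Q \<Longrightarrow> piece (P \<inter> Q)"
  unfolding piece_def by blast

lemma piece_diff: "piece P \<Longrightarrow> piece Q \<Longrightarrow> piece (P - Q)"
  unfolding piece_def same_leg_def by (metis (no_types, lifting) Diff_iff closedin_diff openin_diff openin_imp_subset subsetD)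

lemma piece_top: "piece (X - {v})"
  unfolding piece_def by auto

lemma piece_empty: "piece {}"
  unfolding piece_def by auto

lemma piece_ball:
  assumes "piece P" "x \<in> P"
  obtains \<epsilon> where "\<epsilon> > 0" "\<And>y. y \<in> X - {v} \<Longrightarrow> dist y x < \<epsilon> \<Longrightarrow> y \<in> P"
  using assms unfolding piece_def openin_euclidean_subtopology_iff by metis

lemma piece_limit:
  assumes "piece P" "\<And>n::nat. s n \<in> P" "s \<longlonglongrightarrow> x" "x \<in> X - {v}"
  shows "x \<in> P"
proof -
  obtain C where C: "closed C" "P = (X - {v}) \<inter> C"
    using assms(1) unfolding piece_def closedin_closed by blast
  then have "x \<in> C"
    using assms(2,3) closed_sequentially by blast
  then show ?thesis using C assms(4) by blast
qed

text \<open>The only limit point in \<open>X\<close> that a piece can lack is \<open>v\<close>,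
  where \<open>\<rho>\<close> vanishes; the positive threshold excludes it and so restores
  compactness.\<close>

lemma compact_piece_above:
  assumes "piece P" "t > 0"
  shows "compact {x \<in> P. t \<le> \<rho> x}"
proof -
  obtain C where C: "closed C" "P = (X - {v}) \<inter> C"
    using assms(1) unfolding piece_def closedin_closed by blast
  have "{x \<in> P. t \<le> \<rho> x} = (X \<inter> \<rho> -` {t..}) \<inter> C"
    using C rho_v assms(2) by auto
  moreover have "compact (X \<inter> \<rho> -` {t..})"
    using continuous_on_closed_vimage[OF compact_imp_closed[OF compact_X], of \<rho>] rho_cont compact_X
    by (metis closed_atLeast compact_Int_closed compact_imp_closed continuous_closed_preimage inf.idem inf_assoc)
  ultimately show ?thesis using C compact_Int_closed by simp
qed

lemma height_attained:
  assumes "piece P" "P \<noteq> {}"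
  obtains x where "x \<in> P" "\<rho> x = height P"
proof -
  obtain p where p: "p \<in> P" using assms by blast
  then have "\<rho> p > 0" using rho_pos piece_subset[OF assms(1)] by blast
  let ?K = "{x \<in> P. \<rho> p \<le> \<rho> x}"
  have K: "compact ?K" "?K \<noteq> {}"
    using compact_piece_above[OF assms(1) \<open>\<rho> p > 0\<close>] p by auto
  have cont: "continuous_on ?K \<rho>"
    using rho_cont piece_subset[OF assms(1)] by (auto intro: continuous_on_subset)
  obtain x where x: "x \<in> ?K" "\<forall>y\<in>?K. \<rho> y \<le> \<rho> x"
    using continuous_attains_sup[OF K cont] by metis
  have "\<rho> y \<le> \<rho> x" if "y \<in> P" for y
    using x that by (cases "\<rho> p \<le> \<rho> y") auto
  then have "Sup (\<rho> ` P) = \<rho> x"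
    using x(1) by (intro cSup_eq_maximum) auto
  then show ?thesis using that[of x] x(1) by (simp add: height_def)
qed

lemma height_upper:
  assumes "piece P" "x \<in> P"
  shows "\<rho> x \<le> height P"
proof -
  have "bdd_above (\<rho> ` X)"
    by (intro bounded_imp_bdd_above compact_imp_bounded compact_continuous_image rho_cont compact_X)
  then have "bdd_above (\<rho> ` P)"
    using piece_subset[OF assms(1)] by (meson Diff_subset bdd_above_mono image_mono order_trans)
  then show ?thesis using assms unfolding height_def by (simp add: cSup_upper)
qed

lemma height_pos:
  assumes "piece P" "P \<noteq> {}"
  shows "0 < height P"
  using assms height_upper rho_pos piece_subset by (metis ex_in_conv less_le_trans subsetD)

lemma height_mono:
  assumes "piece P" "piece Q" "P \<subseteq> Q" "P \<noteq> {}"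
  shows "height P \<le> height Q"
  by (metis assms height_attained height_upper subsetD)

text \<open>The truncated pieces are compact, nonempty and decreasing; the last is why
  \<open>t\<close> must not decrease. Thresholds that grow with \<open>n\<close> let a height be
  approached from below in \<open>related_ex\<close>.\<close>

lemma nested_pieces_ex:
  assumes P: "\<And>n. piece (P n)" "\<And>n. P (Suc n) \<subseteq> P n"
    and t: "\<And>n. 0 < t n" "\<And>n. t n \<le> t (Suc n)" and h: "\<And>n. P n \<noteq> {}" "\<And>n. t n \<le> height (P n)"
  shows "\<exists>x. \<forall>n. x \<in> P n \<and> t n \<le> \<rho> x"
proof -
  have "(\<Inter>n. {x \<in> P n. t n \<le> \<rho> x}) \<noteq> {}"
  proof (rule compact_decseq_Inter_nonempty)
    fix n
    show "compact {x \<in> P n. t n \<le> \<rho> x}" by (rule compact_piece_above[OF P(1) t(1)])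
    show "{x \<in> P n. t n \<le> \<rho> x} \<noteq> {}"
      using height_attained[OF P(1) h(1)] h(2) by (metis (mono_tags, lifting) empty_Collect_eq)
    show "{x \<in> P (Suc n). t (Suc n) \<le> \<rho> x} \<subseteq> {x \<in> P n. t n \<le> \<rho> x}"
      using P(2) t(2) by (smt (verit) Collect_mono subsetD)
  qed
  then show ?thesis by blast
qed

text \<open>Density of tops supplies a leg whose height lies in the prescribed interval. Cutting
  with the sets \<open>U k\<close> shrinks \<open>P\<close> to that leg, and by compactness the
  heights shrink too. A highest leg of \<open>P\<close> is too tall to be this leg and gets cut
  away, so the complement keeps the full height.\<close>

lemma piece_splitting:
  assumes P: "piece P" "P \<noteq> {}" and lu: "0 \<le> l" "l < u" "u \<le> height P"
  shows "\<exists>Q. piece Q \<and> Q \<subseteq> P \<and> Q \<noteq> {} \<and> l < height Q \<and> height Q < u \<and>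
           P - Q \<noteq> {} \<and> height (P - Q) = height P"
proof -
  obtain x where x: "x \<in> P" "\<rho> x = height P" using height_attained[OF P] .
  \<comment> \<open>A height strictly between \<open>l\<close> and \<open>u\<close>, realised on the
    leg of the highest point \<open>x\<close>; by continuity tops close to that point have heights
    between \<open>l\<close> and \<open>u\<close> as well.\<close>
  define m where "m = (l + u) / 2"
  have m: "l < m" "m < u" "0 < m" "m \<le> \<rho> x" using lu x by (auto simp: m_def)
  have xX: "x \<in> X - {v}" using x piece_subset P by blast
  obtain z where z: "z \<in> X - {v}" "same_leg z x" "\<rho> z = m"
    using leg_ivt[OF xX \<open>0 < m\<close> \<open>m \<le> \<rho> x\<close>] unfolding same_leg_def by blast
  have zP: "z \<in> P" using P(1) x(1) z unfolding piece_def same_leg_def by blast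
  obtain \<epsilon>1 where \<epsilon>1: "\<epsilon>1 > 0" "\<And>y. y \<in> X - {v} \<Longrightarrow> dist y z < \<epsilon>1 \<Longrightarrow> y \<in> P"
    using piece_ball[OF P(1) zP] by metis
  have "\<exists>\<epsilon>2>0. \<forall>y\<in>X. dist y z < \<epsilon>2 \<longrightarrow> dist (\<rho> y) (\<rho> z) < min (m - l) (u - m)"
    using rho_cont z m unfolding continuous_on_iff by (metis DiffD1 diff_gt_0_iff_gt min_less_iff_conj)
  then obtain \<epsilon>2 where \<epsilon>2: "\<epsilon>2 > 0" "\<And>y. y \<in> X \<Longrightarrow> dist y z < \<epsilon>2 \<Longrightarrow> l < \<rho> y \<and> \<rho> y < u"
    using z(3) by (fastforce simp: dist_real_def)
  obtain e where e: "e \<in> X - {v}" "dist e z < min \<epsilon>1 \<epsilon>2"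
      and top: "\<And>y. y \<in> X - {v} \<Longrightarrow> same_leg y e \<Longrightarrow> \<rho> y \<le> \<rho> e"
    using dense_tops[OF z(1), of "min \<epsilon>1 \<epsilon>2"] \<epsilon>1(1) \<epsilon>2(1) unfolding same_leg_def
    by (metis min_less_iff_conj)
  have eP: "e \<in> P" "l < \<rho> e" "\<rho> e < u" using e \<epsilon>1 \<epsilon>2 by auto
  \<comment> \<open>\<open>N k\<close> keeps the points that agree with \<open>e\<close> on the
    first \<open>k\<close> sets \<open>U 0\<close>, ..., \<open>U (k - 1)\<close>; the intersection
    is the leg of \<open>e\<close>.\<close>
  define N where "N = rec_nat P (\<lambda>k A. if e \<in> U k then A \<inter> U k else A - U k)"
  have N: "N 0 = P" "N (Suc k) = (if e \<in> U k then N k \<inter> U k else N k - U k)" for k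
    by (simp_all add: N_def)
  have pN: "piece (N k)" for k
    by (induction k) (auto simp: N P(1) piece_Int piece_diff piece_U)
  have eN: "e \<in> N k" for k by (induction k) (auto simp: N eP)
  have NS: "N (Suc k) \<subseteq> N k" for k by (auto simp: N)
  have NU: "same_leg y e" if "\<And>k. y \<in> N k" for y
    unfolding same_leg_def using that by (metis DiffD2 IntD2 N(2))
  have "\<not> same_leg x e"
    using top[OF xX] eP(3) x(2) lu(3) by auto
  then have "\<exists>k. x \<notin> N k"
    using NU by blast
  then obtain k1 where k1: "x \<notin> N k1" by blast
  \<comment> \<open>Otherwise compactness yields a point of height at least \<open>u\<close> on the
    leg of \<open>e\<close>, above its top.\<close>
  have "\<exists>k. height (N k) < u"
  proof (rule ccontr)
    assume "\<nexists>k. height (N k) < u"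
    then have "u \<le> height (N k)" for k by (simp add: not_less)
    then have "\<exists>y. \<forall>n. y \<in> N n \<and> u \<le> \<rho> y"
      by (intro nested_pieces_ex[of N "\<lambda>_. u"] pN NS) (use eN lu in auto)
    then obtain y where y: "\<And>n. y \<in> N n" "u \<le> \<rho> y" by blast
    then have "\<rho> y \<le> \<rho> e" using NU top piece_subset[OF pN] by blast
    then show False using y eP by simp
  qed
  then obtain k2 where k2: "height (N k2) < u" by blast
  define k where "k = max k1 k2"
  have anti: "N i \<subseteq> N j" if "j \<le> i" for i j
    using that NS by (rule lift_Suc_antimono_le[rotated])
  have Q: "x \<notin> N k" "height (N k) < u"
    using k1 k2 anti[of k1 k] height_mono[OF pN pN anti[of k2 k]] eN[of k] unfolding k_def by fastforce+
  have NP: "N k \<subseteq> P" using anti[of 0 k] N(1) by simp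
  have PN: "piece (P - N k)" "x \<in> P - N k" using piece_diff[OF P(1) pN] x Q by auto
  have "height (P - N k) = height P"
    using height_upper[OF PN] height_mono[OF PN(1) P(1)] x PN by fastforce
  moreover have "l < height (N k)" using height_upper[OF pN eN, of k] eP by simp
  ultimately show ?thesis using pN NP eN Q PN by (intro exI[of _ "N k"]) blast
qed

end

section \<open>Back-and-forth\<close>

lemma limit_tail_ne:
  fixes g :: "nat \<Rightarrow> 'a::t1_space"
  assumes "g \<longlonglongrightarrow> b" "b \<noteq> c"
  shows "\<exists>k0. \<forall>k. g (k + k0) \<noteq> c"
proof -
  obtain k0 where "\<forall>k\<ge>k0. g k \<noteq> c"
    using tendsto_imp_eventually_ne[OF assms] unfolding eventually_sequentially by blast
  then show ?thesis by (intro exI[of _ k0]) simp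
qed

locale leg_structure_pair = A: leg_structure X v \<rho> U + B: leg_structure Y w \<sigma> V
  for X :: "'a::metric_space set" and v \<rho> U and Y :: "'b::metric_space set" and w \<sigma> V
begin

definition matched :: "real \<Rightarrow> 'a set \<Rightarrow> 'b set \<Rightarrow> bool" where
  "matched a P Q \<longleftrightarrow> A.piece P \<and> B.piece Q \<and> (P = {} \<longleftrightarrow> Q = {}) \<and>
     (P \<noteq> {} \<longrightarrow> B.height Q = exp a * A.height P)"

text \<open>The remainder keeps its height in both spaces, hence the ratio \<open>a\<close>; only
  the cut-off pair gets a new ratio, and \<open>piece_splitting\<close> brings it within
  \<open>\<epsilon>\<close> of the old one.\<close>

lemma match_small_part:
  assumes m: "matched a P Q" and S: "A.piece S" "S \<subseteq> P" "S \<noteq> {}" "P - S \<noteq> {}"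
    and h: "A.height (P - S) = A.height P" and "\<epsilon> > 0"
  shows "\<exists>R b. R \<subseteq> Q \<and> matched b S R \<and> matched a (P - S) (Q - R) \<and> \<bar>b - a\<bar> < \<epsilon>"
proof -
  have ne: "P \<noteq> {}" "Q \<noteq> {}" and P: "A.piece P" and Q: "B.piece Q"
    and hQ: "B.height Q = exp a * A.height P"
    using m S unfolding matched_def by auto
  have Spos: "0 < A.height S" using A.height_pos S by blast
  \<comment> \<open>The height of \<open>R\<close> is sought strictly between
    \<open>exp (a - \<epsilon>)\<close> and \<open>exp a\<close> times the height of
    \<open>S\<close>, which places \<open>b\<close> between \<open>a - \<epsilon>\<close> and
    \<open>a\<close>.\<close>
  define u where "u = exp a * A.height S"
  define l where "l = exp (- \<epsilon>) * u"
  have u: "0 < u" "u \<le> B.height Q"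
    using Spos A.height_mono[OF S(1) P S(2,3)] by (auto simp: u_def hQ)
  have l: "0 \<le> l" "l < u" using u \<open>\<epsilon> > 0\<close> by (auto simp: l_def)
  obtain R where R: "B.piece R" "R \<subseteq> Q" "R \<noteq> {}" "l < B.height R" "B.height R < u"
      "Q - R \<noteq> {}" "B.height (Q - R) = B.height Q"
    using B.piece_splitting[OF Q ne(2) l u(2)] by blast
  define b where "b = ln (B.height R / A.height S)"
  have Rpos: "0 < B.height R" using R l by linarith
  have eb: "exp b = B.height R / A.height S" unfolding b_def using Rpos Spos by simp
  then have "exp b < exp a" using R(5) Spos by (simp only: u_def pos_divide_less_eq)
  moreover have "exp (a - \<epsilon>) < exp b"
    using R(4) Spos unfolding eb l_def u_def pos_less_divide_eq[OF Spos]
    by (simp add: exp_diff exp_minus divide_inverse mult_ac)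
  ultimately have "\<bar>b - a\<bar> < \<epsilon>" by auto
  moreover have "matched b S R"
    unfolding matched_def using S R Spos eb by auto
  moreover have "matched a (P - S) (Q - R)"
    unfolding matched_def using S R h hQ A.piece_diff[OF P S(1)] B.piece_diff[OF Q R(1)] by auto
  ultimately show ?thesis using R by blast
qed

text \<open>The half that contains a highest point of \<open>P\<close> keeps the height of
  \<open>P\<close>, so the other half can serve as the small part in
  \<open>match_small_part\<close>.\<close>

lemma match_split:
  assumes m: "matched a P Q" and W: "A.piece W" and e: "\<epsilon> > 0"
  shows "\<exists>R b c. R \<subseteq> Q \<and> matched b (P \<inter> W) R \<and> matched c (P - W) (Q - R) \<and> \<bar>b - a\<bar> < \<epsilon> \<and> \<bar>c - a\<bar> < \<epsilon>"
proof -
  have P: "A.piece P" and Q: "B.piece Q" using m unfolding matched_def by auto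
  have pieces: "A.piece (P \<inter> W)" "A.piece (P - W)"
    using A.piece_Int[OF P W] A.piece_diff[OF P W] by auto
  have matched_empty: "matched a {} {}"
    unfolding matched_def by (simp add: A.piece_empty B.piece_empty)
  consider "P \<inter> W = {}" | "P - W = {}" | "P \<inter> W \<noteq> {}" "P - W \<noteq> {}" by blast
  then show ?thesis
  proof cases
    case 1
    then have "P - W = P" by blast
    then show ?thesis using 1 m matched_empty e by (intro exI[of _ "{}"] exI[of _ a]) simp
  next
    case 2
    then have "P \<inter> W = P" by blast
    then show ?thesis using m matched_empty e unfolding 2 by (intro exI[of _ Q] exI[of _ a]) simp
  next
    case 3
    obtain x where x: "x \<in> P" "\<rho> x = A.height P" using A.height_attained[OF P] 3 by blast
    show ?thesis
    proof (cases "x \<in> W")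
      case True
      have eq: "P - (P - W) = P \<inter> W" by blast
      have "A.height (P \<inter> W) = A.height P"
        using A.height_upper[OF pieces(1), of x] A.height_mono[OF pieces(1) P] x True 3 by force
      then obtain R b where "R \<subseteq> Q" "matched b (P - W) R" "matched a (P \<inter> W) (Q - R)" "\<bar>b - a\<bar> < \<epsilon>"
        using match_small_part[OF m pieces(2) _ _ _ _ e] 3 unfolding eq by blast
      moreover from this have "Q - (Q - R) = R" by blast
      ultimately show ?thesis using e
        by (intro exI[of _ "Q - R"] exI[of _ a] exI[of _ b]) auto
    next
      case False
      have eq: "P - (P \<inter> W) = P - W" by blast
      have "A.height (P - W) = A.height P"
        using A.height_upper[OF pieces(2), of x] A.height_mono[OF pieces(2) P] x False 3 by force
      then obtain R b where "R \<subseteq> Q" "matched b (P \<inter> W) R" "matched a (P - W) (Q - R)" "\<bar>b - a\<bar> < \<epsilon>"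
        using match_small_part[OF m pieces(1) _ _ _ _ e] 3 unfolding eq by blast
      then show ?thesis using e by (intro exI[of _ R] exI[of _ b] exI[of _ a]) auto
    qed
  qed
qed

end

section \<open>Symmetry of matching, and the homeomorphism defined by a matched tree\<close>

lemma leg_structure_pair_swap:
  "leg_structure_pair X v \<rho> U Y w \<sigma> V \<Longrightarrow> leg_structure_pair Y w \<sigma> V X v \<rho> U"
  unfolding leg_structure_pair_def by blast

text \<open>Exchanging the spaces inverts the ratio. This symmetry yields the splits along sets of
  \<open>Y\<close>, the inverse of the limit map and the continuity of that map at the top.\<close>

lemma (in leg_structure_pair) matched_swap:
  "leg_structure_pair.matched Y w \<sigma> V X v \<rho> U (- a) Q P \<longleftrightarrow> matched a P Q"
proof -
  interpret S: leg_structure_pair Y w \<sigma> V X v \<rho> U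
    using leg_structure_pair_swap leg_structure_pair_axioms by blast
  show ?thesis unfolding S.matched_def matched_def by (auto simp: exp_minus field_simps)
qed

text \<open>The increments of \<open>a\<close> are summable along each branch, so the ratios
  converge. \<open>P_U\<close> and \<open>Q_V\<close> resolve every separating set at a finite
  level, so the pieces along a branch shrink to at most one leg in each space.\<close>

locale matched_tree = leg_structure_pair X v \<rho> U Y w \<sigma> V
  for X :: "'a::metric_space set" and v \<rho> U and Y :: "'b::metric_space set" and w \<sigma> V +
  fixes P :: "bool list \<Rightarrow> 'a set" and Q :: "bool list \<Rightarrow> 'b set" and a :: "bool list \<Rightarrow> real"
  assumes P_Nil: "P [] = X - {v}" and Q_Nil: "Q [] = Y - {w}"
    and match: "matched (a s) (P s) (Q s)"
    and P_Un: "P s = P (True # s) \<union> P (False # s)" and P_disj: "P (True # s) \<inter> P (False # s) = {}"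
    and Q_Un: "Q s = Q (True # s) \<union> Q (False # s)" and Q_disj: "Q (True # s) \<inter> Q (False # s) = {}"
    and a_step: "\<bar>a (b # s) - a s\<bar> \<le> (1/2) ^ length s"
    and P_U: "\<exists>k. \<forall>s. length s = k \<longrightarrow> P s \<subseteq> U n \<or> P s \<inter> U n = {}"
    and Q_V: "\<exists>k. \<forall>s. length s = k \<longrightarrow> Q s \<subseteq> V n \<or> Q s \<inter> V n = {}"
begin

lemma matched_tree_swap: "matched_tree Y w \<sigma> V X v \<rho> U Q P (\<lambda>s. - a s)"
proof -
  interpret S: leg_structure_pair Y w \<sigma> V X v \<rho> U
    using leg_structure_pair_swap leg_structure_pair_axioms by blast
  show ?thesis
  proof
    fix s b
    show "S.matched (- a s) (Q s) (P s)" using match matched_swap by blast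
    show "\<bar>- a (b # s) - - a s\<bar> \<le> (1 / 2) ^ length s"
      using a_step[of b s] by (simp add: abs_minus_commute)
  qed (fact P_Nil Q_Nil P_Un Q_Un P_disj Q_disj P_U Q_V)+
qed

lemma piece_P: "A.piece (P s)" and piece_Q: "B.piece (Q s)"
  using match matched_def by auto

lemma branch_ex: "x \<in> X - {v} \<Longrightarrow> \<exists>s. length s = n \<and> x \<in> P s"
proof (induction n)
  case 0 then show ?case using P_Nil by simp
next
  case (Suc n) then show ?case using P_Un by (metis UnE length_Cons)
qed

lemma branch_unique: "length s = length t \<Longrightarrow> x \<in> P s \<Longrightarrow> x \<in> P t \<Longrightarrow> s = t"
proof (induction s t rule: list_induct2)
  case (Cons b s c t)
  have "x \<in> P s" "x \<in> P t" using Cons.prems P_Un by (metis UnCI)+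
  then have "s = t" using Cons.IH by blast
  moreover have "b = c"
    using Cons.prems P_disj[of s] \<open>s = t\<close> by (cases b; cases c) auto
  ultimately show ?case by simp
qed simp

text \<open>The points lie on the same branch, and the logarithm of the ratio of their heights is
  the limit of \<open>a\<close> along it: \<open>2 * (1/2) ^ n\<close> is the tail of the geometric
  series from level \<open>n\<close> on. Stating a bound at each level, and not a limit, makes the
  relation pass to limits of points.\<close>

definition related :: "'a \<Rightarrow> 'b \<Rightarrow> bool" where
  "related x y \<longleftrightarrow> (\<forall>n. \<exists>s. length s = n \<and> x \<in> P s \<and> y \<in> Q s \<and> \<bar>ln (\<sigma> y) - ln (\<rho> x) - a s\<bar> \<le> 2 * (1/2) ^ n)"

lemma related_in: "related x y \<Longrightarrow> x \<in> X - {v} \<and> y \<in> Y - {w}"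
  unfolding related_def using P_Nil Q_Nil by (metis length_0_conv)

text \<open>Compactness along the branch of \<open>x\<close> gives the leg of \<open>y\<close>, and
  the limit \<open>\<alpha>\<close> of \<open>a\<close> along it gives the height
  \<open>exp \<alpha> * \<rho> x\<close>.\<close>

lemma related_ex:
  assumes x: "x \<in> X - {v}"
  shows "\<exists>y. related x y"
proof -
  obtain br where br: "\<And>n. length (br n) = n" "\<And>n. x \<in> P (br n)"
    using branch_ex[OF x] by metis
  have br_Suc: "\<exists>b. br (Suc n) = b # br n" for n
  proof -
    obtain b t where bt: "br (Suc n) = b # t" "length t = n"
      using br(1)[of "Suc n"] by (metis length_Suc_conv)
    then have "x \<in> P t" using br(2)[of "Suc n"] P_Un[of t] by (cases b) auto
    then have "t = br n" using branch_unique[of t "br n"] br bt by auto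
    then show ?thesis using bt by blast
  qed
  define c where "c n = a (br n)" for n
  have step: "\<bar>c (Suc n) - c n\<bar> \<le> (1/2) ^ n" for n
    using br_Suc[of n] a_step br(1) unfolding c_def by metis
  \<comment> \<open>Nested intervals around \<open>c n\<close> whose common point is the limit of
    \<open>c\<close>; half their length is the tail bound that \<open>related\<close> asks
    for.\<close>
  define lo where "lo n = c n - 2 * (1/2) ^ n" for n
  define hi where "hi n = c n + 2 * (1/2) ^ n" for n
  have lo: "lo n \<le> lo (Suc n)" and hi: "hi (Suc n) \<le> hi n" for n
    using step[of n] by (auto simp: lo_def hi_def)
  have lohi: "lo m \<le> hi n" for m n
  proof -
    have "lo m \<le> lo (max m n)" by (rule lift_Suc_mono_le[of lo]) (auto simp: lo)
    also have "\<dots> \<le> hi (max m n)" by (simp add: lo_def hi_def)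
    also have "\<dots> \<le> hi n" by (rule lift_Suc_antimono_le[of hi]) (auto simp: hi)
    finally show ?thesis .
  qed
  define \<alpha> where "\<alpha> = (SUP n. lo n)"
  have "bdd_above (range lo)" using lohi by (auto intro!: bdd_aboveI[of _ "hi 0"])
  then have \<alpha>: "lo n \<le> \<alpha>" "\<alpha> \<le> hi n" for n
    using lohi unfolding \<alpha>_def by (auto intro!: cSUP_upper cSUP_least)
  have \<alpha>c: "\<bar>\<alpha> - c n\<bar> \<le> 2 * (1/2) ^ n" for n
    using \<alpha>[of n] unfolding lo_def hi_def by (simp add: abs_le_iff)
  have rx: "0 < \<rho> x" using A.rho_pos x by blast
  have Q_Suc: "Q (br (Suc n)) \<subseteq> Q (br n)" for n
    using br_Suc[of n] Q_Un[of "br n"] by (metis (full_types) Un_upper1 Un_upper2)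
  \<comment> \<open>The matched pieces are high enough because \<open>c n\<close> is at least
    \<open>\<alpha> - 2 * (1/2) ^ n\<close>; the thresholds chosen here increase to
    \<open>exp \<alpha> * \<rho> x\<close>.\<close>
  have "\<exists>z. \<forall>n. z \<in> Q (br n) \<and> exp (\<alpha> - 4 * (1/2) ^ n) * \<rho> x \<le> \<sigma> z"
  proof (rule B.nested_pieces_ex[of "\<lambda>n. Q (br n)"])
    fix n
    show "Q (br n) \<noteq> {}" using match[of "br n"] br(2)[of n] unfolding matched_def by blast
    have "exp (\<alpha> - 4 * (1/2) ^ n) * \<rho> x \<le> exp (c n) * A.height (P (br n))"
    proof (rule mult_mono)
      show "exp (\<alpha> - 4 * (1/2) ^ n) \<le> exp (c n)"
        using \<alpha>c[of n] zero_le_power[of "1/2::real" n] by (simp add: abs_le_iff)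
    qed (use rx A.height_upper[OF piece_P br(2)] in auto)
    also have "\<dots> = B.height (Q (br n))"
      using match[of "br n"] br(2)[of n] unfolding matched_def c_def by force
    finally show "exp (\<alpha> - 4 * (1/2) ^ n) * \<rho> x \<le> B.height (Q (br n))" .
  qed (use rx piece_Q Q_Suc in auto)
  then obtain z where z: "\<And>n. z \<in> Q (br n)" and zl: "\<And>n. exp (\<alpha> - 4 * (1/2) ^ n) * \<rho> x \<le> \<sigma> z"
    by blast
  have zY: "z \<in> Y - {w}" using z B.piece_subset[OF piece_Q] by blast
  have "(\<lambda>n. exp (\<alpha> - 4 * (1/2) ^ n) * \<rho> x) \<longlonglongrightarrow> exp (\<alpha> - 4 * 0) * \<rho> x"
    by (intro tendsto_intros LIMSEQ_power_zero) auto
  then have "exp \<alpha> * \<rho> x \<le> \<sigma> z"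
    using LIMSEQ_le_const2[of _ "exp \<alpha> * \<rho> x" "\<sigma> z"] zl by auto
  \<comment> \<open>\<open>z\<close> may be too high. Moving down its leg to the exact height stays
    inside all \<open>Q (br n)\<close>, because pieces are unions of legs.\<close>
  then obtain y where y: "y \<in> Y - {w}" "B.same_leg z y" "\<sigma> y = exp \<alpha> * \<rho> x"
    using B.leg_ivt[OF zY, of "exp \<alpha> * \<rho> x"] rx unfolding B.same_leg_def by auto
  have yQ: "y \<in> Q (br n)" for n
    using piece_Q[of "br n"] z[of n] y unfolding B.piece_def by blast
  have "ln (\<sigma> y) - ln (\<rho> x) = \<alpha>" using y rx by (simp add: ln_mult)
  then have "related x y"
    unfolding related_def using br yQ \<alpha>c c_def by metis
  then show ?thesis ..
qed

text \<open>At each level both points lie in the same piece, so no \<open>V n\<close> separates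
  them, and the logarithms of their heights differ by at most \<open>4 * (1/2) ^ n\<close>.\<close>

lemma related_unique:
  assumes "related x y" "related x z"
  shows "y = z"
proof (rule B.leg_inj)
  have in_Y: "x \<in> X - {v}" "y \<in> Y - {w}" "z \<in> Y - {w}" using assms related_in by blast+
  then show "y \<in> Y - {w}" "z \<in> Y - {w}" by blast+
  have common: "\<exists>s. length s = n \<and> y \<in> Q s \<and> z \<in> Q s \<and> \<bar>ln (\<sigma> y) - ln (\<sigma> z)\<bar> \<le> 4 * (1/2) ^ n" for n
  proof -
    obtain s where s: "length s = n" "x \<in> P s" "y \<in> Q s" "\<bar>ln (\<sigma> y) - ln (\<rho> x) - a s\<bar> \<le> 2 * (1/2) ^ n"
      using assms(1) unfolding related_def by blast
    obtain t where t: "length t = n" "x \<in> P t" "z \<in> Q t" "\<bar>ln (\<sigma> z) - ln (\<rho> x) - a t\<bar> \<le> 2 * (1/2) ^ n"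
      using assms(2) unfolding related_def by blast
    have "s = t" using branch_unique s t by metis
    then show ?thesis using s t by (intro exI[of _ s]) auto
  qed
  show "\<forall>n. y \<in> V n \<longleftrightarrow> z \<in> V n"
  proof
    fix n
    obtain k where k: "\<forall>s. length s = k \<longrightarrow> Q s \<subseteq> V n \<or> Q s \<inter> V n = {}" using Q_V[of n] by blast
    then show "y \<in> V n \<longleftrightarrow> z \<in> V n" using common[of k] by blast
  qed
  have "(\<lambda>n. 4 * (1/2) ^ n) \<longlonglongrightarrow> 4 * (0::real)"
    by (intro tendsto_intros LIMSEQ_power_zero) auto
  moreover have "\<bar>ln (\<sigma> y) - ln (\<sigma> z)\<bar> \<le> 4 * (1/2) ^ n" for n using common by blast
  ultimately have "\<bar>ln (\<sigma> y) - ln (\<sigma> z)\<bar> \<le> 4 * 0"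
    by (intro LIMSEQ_le_const[of "\<lambda>n. 4 * (1/2) ^ n"]) auto
  then show "\<sigma> y = \<sigma> z" using B.rho_pos in_Y by simp
qed

text \<open>Pieces are open off the top, so at each level the points \<open>p k\<close> eventually
  share the piece of \<open>x\<close>. This fixes the piece that contains \<open>q k\<close>, and
  closedness carries the condition to the limit.\<close>

lemma related_limit:
  assumes rel: "\<And>k::nat. related (p k) (q k)" and p: "p \<longlonglongrightarrow> x" "x \<in> X - {v}" and q: "q \<longlonglongrightarrow> y" "y \<in> Y"
  shows "related x y"
proof -
  have pX: "p k \<in> X - {v}" and qY: "q k \<in> Y - {w}" for k using rel related_in by blast+
  have lim_p: "(\<lambda>k. \<rho> (p k)) \<longlonglongrightarrow> \<rho> x"
    using A.rho_cont p pX by (auto intro: continuous_on_tendsto_compose[of X \<rho>])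
  have lim_q: "(\<lambda>k. \<sigma> (q k)) \<longlonglongrightarrow> \<sigma> y"
    using B.rho_cont q qY by (auto intro: continuous_on_tendsto_compose[of Y \<sigma>])
  have ev: "\<exists>s. length s = n \<and> x \<in> P s \<and>
     (\<exists>k0. \<forall>k\<ge>k0. q k \<in> Q s \<and> \<bar>ln (\<sigma> (q k)) - ln (\<rho> (p k)) - a s\<bar> \<le> 2 * (1/2) ^ n)" for n
  proof -
    obtain s where s: "length s = n" "x \<in> P s" using branch_ex[OF p(2)] by blast
    obtain e where e: "e > 0" "\<And>y. y \<in> X - {v} \<Longrightarrow> dist y x < e \<Longrightarrow> y \<in> P s"
      using A.piece_ball[OF piece_P s(2)] by metis
    obtain k0 where "\<And>k. k \<ge> k0 \<Longrightarrow> dist (p k) x < e"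
      using p(1) e(1) unfolding lim_sequentially by blast
    then have pk: "p k \<in> P s" if "k \<ge> k0" for k using e(2) pX that by blast
    have "q k \<in> Q s \<and> \<bar>ln (\<sigma> (q k)) - ln (\<rho> (p k)) - a s\<bar> \<le> 2 * (1/2) ^ n" if k: "k \<ge> k0" for k
    proof -
      obtain t where t: "length t = n" "p k \<in> P t" "q k \<in> Q t"
          "\<bar>ln (\<sigma> (q k)) - ln (\<rho> (p k)) - a t\<bar> \<le> 2 * (1/2) ^ n"
        using rel[of k] unfolding related_def by blast
      then have "t = s" using branch_unique pk[OF k] s by metis
      then show ?thesis using t by simp
    qed
    then show ?thesis using s by blast
  qed
  have rx: "0 < \<rho> x" using A.rho_pos p by blast
  \<comment> \<open>Already the bound at level 0 keeps \<open>\<sigma> (q k)\<close> above a fixed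
    multiple of \<open>\<rho> (p k)\<close>, whose limit is positive.\<close>
  have "y \<noteq> w"
  proof
    assume "y = w"
    obtain s k0 where "\<forall>k\<ge>k0. \<bar>ln (\<sigma> (q k)) - ln (\<rho> (p k)) - a s\<bar> \<le> 2"
      using ev[of 0] by auto
    then have "exp (a s - 2) * \<rho> (p k) \<le> \<sigma> (q k)" if "k \<ge> k0" for k
    proof -
      have "exp (a s - 2 + ln (\<rho> (p k))) \<le> exp (ln (\<sigma> (q k)))"
        using \<open>\<forall>k\<ge>k0. _\<close> that by (smt (verit) exp_le_cancel_iff)
      then show ?thesis using A.rho_pos[OF pX] B.rho_pos[OF qY] by (simp add: exp_add)
    qed
    then have "exp (a s - 2) * \<rho> x \<le> \<sigma> y"
      by (intro LIMSEQ_le[OF tendsto_mult_left[OF lim_p] lim_q]) blast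
    then show False using rx \<open>y = w\<close> B.rho_v by (simp add: mult_le_0_iff)
  qed
  then have yY: "y \<in> Y - {w}" using q by blast
  have ry: "0 < \<sigma> y" using B.rho_pos yY by blast
  show ?thesis
    unfolding related_def
  proof
    fix n
    obtain s k0 where s: "length s = n" "x \<in> P s"
      and k0: "\<And>k. k \<ge> k0 \<Longrightarrow> q k \<in> Q s \<and> \<bar>ln (\<sigma> (q k)) - ln (\<rho> (p k)) - a s\<bar> \<le> 2 * (1/2) ^ n"
      using ev[of n] by blast
    have "y \<in> Q s"
      using B.piece_limit[OF piece_Q _ LIMSEQ_ignore_initial_segment[OF q(1), of k0] yY] k0 by auto
    moreover have "(\<lambda>k. \<bar>ln (\<sigma> (q k)) - ln (\<rho> (p k)) - a s\<bar>) \<longlonglongrightarrow> \<bar>ln (\<sigma> y) - ln (\<rho> x) - a s\<bar>"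
      using lim_p lim_q rx ry by (intro tendsto_intros) auto
    then have "\<bar>ln (\<sigma> y) - ln (\<rho> x) - a s\<bar> \<le> 2 * (1/2) ^ n"
      using LIMSEQ_le_const2 k0 by blast
    ultimately show "\<exists>s. length s = n \<and> x \<in> P s \<and> y \<in> Q s \<and> \<bar>ln (\<sigma> y) - ln (\<rho> x) - a s\<bar> \<le> 2 * (1/2) ^ n"
      using s by blast
  qed
qed

lemma related_swap: "matched_tree.related \<sigma> \<rho> Q P (\<lambda>s. - a s) y x \<longleftrightarrow> related x y"
proof -
  interpret S: matched_tree Y w \<sigma> V X v \<rho> U Q P "\<lambda>s. - a s" by (rule matched_tree_swap)
  have "\<bar>ln (\<sigma> y) - ln (\<rho> x) - a s\<bar> = \<bar>ln (\<rho> x) - ln (\<sigma> y) - - a s\<bar>" for s by linarith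
  then show ?thesis unfolding S.related_def related_def by auto
qed

text \<open>The relation is a bijection off the tops. Its graph, completed by \<open>(v, w)\<close>,
  is closed, and a map into a compact space with closed graph is continuous.\<close>

theorem homeomorphic: "\<exists>F G. homeomorphism X Y F G"
proof -
  interpret S: matched_tree Y w \<sigma> V X v \<rho> U Q P "\<lambda>s. - a s" by (rule matched_tree_swap)
  define F where "F x = (if x = v then w else (THE y. related x y))" for x
  have Fv: "F v = w" by (simp add: F_def)
  have F: "related x (F x)" if "x \<in> X - {v}" for x
    using related_ex[OF that] related_unique that unfolding F_def by (auto intro: theI2)
  have FY: "F x \<in> Y" if "x \<in> X" for x
    using that F related_in Fv B.v_in by (cases "x = v") auto
  have F_eq_w: "x = v" if "x \<in> X" "F x = w" for x
    using that F related_in by blast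
  have inj: "inj_on F X"
  proof (rule inj_onI)
    fix x y assume xy: "x \<in> X" "y \<in> X" "F x = F y"
    show "x = y"
    proof (cases "x = v \<or> y = v")
      case True then show ?thesis using xy F_eq_w Fv by metis
    next
      case False
      then have "related x (F x)" "related y (F x)" using F[of x] F[of y] xy by auto
      then show ?thesis using S.related_unique related_swap by blast
    qed
  qed
  have onto: "F ` X = Y"
  proof
    show "F ` X \<subseteq> Y" using FY by blast
    show "Y \<subseteq> F ` X"
    proof
      fix y assume y: "y \<in> Y"
      show "y \<in> F ` X"
      proof (cases "y = w")
        case True then show ?thesis using Fv A.v_in by blast
      next
        case False
        then obtain x where x: "related x y" using S.related_ex[of y] y related_swap by blast
        then have "F x = y" using F related_in related_unique by blast
        then show ?thesis using x related_in by blast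
      qed
    qed
  qed
  have graph: "F x = y" if p: "\<And>k::nat. p k \<in> X" "p \<longlonglongrightarrow> x" "x \<in> X" and y: "(\<lambda>k. F (p k)) \<longlonglongrightarrow> y" "y \<in> Y" for p x y
  proof -
    show ?thesis
    proof (cases "x = v")
      case False
      then obtain k0 where k0: "\<forall>k. p (k + k0) \<noteq> v" using limit_tail_ne[OF p(2)] by blast
      then have "related (p (k + k0)) (F (p (k + k0)))" for k using F p(1) by blast
      then have "related x y"
        by (rule related_limit[OF _ LIMSEQ_ignore_initial_segment[OF p(2)] _
              LIMSEQ_ignore_initial_segment[OF y(1)] y(2)]) (use False p in simp)
      then show ?thesis using F p False related_unique by blast
    next
      \<comment> \<open>At the top the limit lemma is applied to the inverse relation: a limit
        \<open>y \<noteq> w\<close> would be related to \<open>v\<close>, but related points avoid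
        the tops.\<close>
      case True
      show ?thesis
      proof (rule ccontr)
        assume "F x \<noteq> y"
        then have "y \<noteq> w" using True Fv by simp
        then obtain k0 where k0: "\<forall>k. F (p (k + k0)) \<noteq> w" using limit_tail_ne[OF y(1)] by blast
        then have "p (k + k0) \<in> X - {v}" for k using p(1) Fv by auto
        then have "S.related (F (p (k + k0))) (p (k + k0))" for k using F related_swap by blast
        then have "S.related y x"
          by (rule S.related_limit[OF _ LIMSEQ_ignore_initial_segment[OF y(1)] _
                LIMSEQ_ignore_initial_segment[OF p(2)] p(3)]) (use \<open>y \<noteq> w\<close> y in simp)
        then show False using related_swap related_in True by blast
      qed
    qed
  qed
  have cont: "continuous_on X F"
    unfolding continuous_on_sequentially
  proof (intro allI ballI impI)
    fix p x assume x: "x \<in> X" and "(\<forall>n. p n \<in> X) \<and> p \<longlonglongrightarrow> x"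
    then have p: "\<And>n. p n \<in> X" "p \<longlonglongrightarrow> x" by auto
    show "(F \<circ> p) \<longlonglongrightarrow> F x"
    proof (rule ccontr)
      assume "\<not> (F \<circ> p) \<longlonglongrightarrow> F x"
      then obtain \<epsilon> where \<epsilon>: "\<epsilon> > 0" "\<forall>k0. \<exists>k\<ge>k0. \<epsilon> \<le> dist (F (p k)) (F x)"
        unfolding lim_sequentially by (auto simp: not_less)
      then have "infinite {k. \<epsilon> \<le> dist (F (p k)) (F x)}"
        unfolding infinite_nat_iff_unbounded_le by auto
      from infinite_enumerate[OF this]
      obtain r where r: "strict_mono r" "\<And>k::nat. \<epsilon> \<le> dist (F (p (r k))) (F x)"
        by auto
      \<comment> \<open>Values bounded away from \<open>F x\<close> have a convergent subsequence in
        the compact \<open>Y\<close>; the closed graph forces its limit to be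
        \<open>F x\<close>.\<close>
      obtain y r' where y: "y \<in> Y" "strict_mono r'" "((\<lambda>k. F (p (r k))) \<circ> r') \<longlonglongrightarrow> y"
        by (rule seq_compactE[OF B.compact_X[unfolded compact_eq_seq_compact_metric]]) (use FY p(1) in auto)
      have "F x = y"
      proof (rule graph)
        show "(\<lambda>k. p (r (r' k))) \<longlonglongrightarrow> x"
          using LIMSEQ_subseq_LIMSEQ[OF LIMSEQ_subseq_LIMSEQ[OF p(2) r(1)] y(2)] by (simp add: o_def)
      qed (use p x y in \<open>auto simp: o_def\<close>)
      then have "(\<lambda>k. dist (F (p (r (r' k)))) (F x)) \<longlonglongrightarrow> 0"
        using y(3) by (simp add: o_def tendsto_dist_iff[symmetric])
      then have "\<epsilon> \<le> 0" by (rule LIMSEQ_le_const) (use r(2) in blast)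
      then show False using \<epsilon> by simp
    qed
  qed
  show ?thesis using homeomorphism_compact[OF A.compact_X cont onto inj] by blast
qed

end

section \<open>Existence of a matched tree\<close>

lemma (in leg_structure_pair) matched_tree_ex: "\<exists>P Q a. matched_tree X v \<rho> U Y w \<sigma> V P Q a"
proof -
  interpret S: leg_structure_pair Y w \<sigma> V X v \<rho> U
    using leg_structure_pair_swap leg_structure_pair_axioms by blast
  define good where "good = (\<lambda>(P, Q, a). matched a P Q)"
  \<comment> \<open>Even levels split along \<open>U\<close> in \<open>X\<close> and odd levels
    along \<open>V\<close> in \<open>Y\<close>; the index \<open>n div 2\<close> runs through all
    sets on both sides.\<close>
  define step where "step = (\<lambda>n (P, Q, a) (P1, Q1, a1) (P2, Q2, a2).
     P = P1 \<union> P2 \<and> P1 \<inter> P2 = {} \<and> Q = Q1 \<union> Q2 \<and> Q1 \<inter> Q2 = {} \<and>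
     \<bar>a1 - a\<bar> \<le> (1/2::real) ^ n \<and> \<bar>a2 - a\<bar> \<le> (1/2::real) ^ n \<and>
     (if even n then P1 \<subseteq> U (n div 2) \<and> P2 \<inter> U (n div 2) = {} else Q1 \<subseteq> V (n div 2) \<and> Q2 \<inter> V (n div 2) = {}))"
  define t0 where "t0 = (X - {v}, Y - {w}, ln (B.height (Y - {w}) / A.height (X - {v})))"
  have "good t0"
    using A.nonempty B.nonempty A.piece_top B.piece_top A.height_pos[OF A.piece_top A.nonempty]
      B.height_pos[OF B.piece_top B.nonempty] by (simp add: good_def t0_def matched_def)
  moreover have "\<exists>t1 t2. good t1 \<and> good t2 \<and> step n t t1 t2" if "good t" for n t
  proof -
    obtain P Q a where t: "t = (P, Q, a)" by (cases t)
    have m: "matched a P Q" using that by (simp add: good_def t)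
    have pos: "0 < (1/2::real) ^ n" by simp
    show ?thesis
    proof (cases "even n")
      case True
      obtain R b c where "R \<subseteq> Q" "matched b (P \<inter> U (n div 2)) R" "matched c (P - U (n div 2)) (Q - R)"
          "\<bar>b - a\<bar> < (1/2) ^ n" "\<bar>c - a\<bar> < (1/2) ^ n"
        using match_split[OF m A.piece_U pos] by blast
      then show ?thesis using True
        by (intro exI[of _ "(P \<inter> U (n div 2), R, b)"] exI[of _ "(P - U (n div 2), Q - R, c)"])
          (auto simp: good_def step_def t)
    next
      case False
      \<comment> \<open>Here the split is prescribed in \<open>Y\<close>, so
        \<open>match_split\<close> is used with the spaces exchanged.\<close>
      have m': "S.matched (- a) Q P" using m matched_swap by blast
      obtain R b c where R: "R \<subseteq> P" "S.matched b (Q \<inter> V (n div 2)) R" "S.matched c (Q - V (n div 2)) (P - R)"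
          "\<bar>b - - a\<bar> < (1/2) ^ n" "\<bar>c - - a\<bar> < (1/2) ^ n"
        using S.match_split[OF m' B.piece_U pos] by blast
      then have "matched (- b) R (Q \<inter> V (n div 2))" "matched (- c) (P - R) (Q - V (n div 2))"
        using matched_swap[of "- b"] matched_swap[of "- c"] by simp_all
      then show ?thesis using False R
        by (intro exI[of _ "(R, Q \<inter> V (n div 2), - b)"] exI[of _ "(P - R, Q - V (n div 2), - c)"])
          (auto simp: good_def step_def t)
    qed
  qed
  ultimately obtain T where T: "T [] = t0" "\<And>s. good (T s)"
      "\<And>s. step (length s) (T s) (T (True # s)) (T (False # s))"
    using tree_choice[of good t0 step] by blast
  define P where "P s = fst (T s)" for s
  define Q where "Q s = fst (snd (T s))" for s
  define a where "a s = snd (snd (T s))" for s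
  have st: "step (length s) (P s, Q s, a s) (P (True # s), Q (True # s), a (True # s))
     (P (False # s), Q (False # s), a (False # s))" for s
    using T(3)[of s] by (simp add: P_def Q_def a_def)
  note st' = st[unfolded step_def, simplified]
  have "matched_tree X v \<rho> U Y w \<sigma> V P Q a"
  proof
    fix s b
    show "P [] = X - {v}" "Q [] = Y - {w}" by (simp_all add: P_def Q_def T(1) t0_def)
    show "matched (a s) (P s) (Q s)"
      using T(2)[of s] by (simp add: good_def P_def Q_def a_def case_prod_unfold)
    show "P s = P (True # s) \<union> P (False # s)" "P (True # s) \<inter> P (False # s) = {}"
      "Q s = Q (True # s) \<union> Q (False # s)" "Q (True # s) \<inter> Q (False # s) = {}"
      using st'[of s] by blast+
    show "\<bar>a (b # s) - a s\<bar> \<le> (1/2) ^ length s"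
      using st'[of s] by (cases b) (simp_all add: power_one_over)
  next
    fix n
    \<comment> \<open>Nodes of length \<open>2 * n\<close> are split along \<open>U n\<close>, so it
      is resolved at their children; \<open>V n\<close> follows one level later.\<close>
    have "P s \<subseteq> U n \<or> P s \<inter> U n = {}" if s: "length s = Suc (2 * n)" for s
    proof -
      obtain b t where "s = b # t" "length t = 2 * n" using s by (metis length_Suc_conv)
      then show ?thesis using st'[of t] by (cases b) auto
    qed
    then show "\<exists>k. \<forall>s. length s = k \<longrightarrow> P s \<subseteq> U n \<or> P s \<inter> U n = {}" by blast
    have "Q s \<subseteq> V n \<or> Q s \<inter> V n = {}" if s: "length s = Suc (Suc (2 * n))" for s
    proof -
      obtain b t where "s = b # t" "length t = Suc (2 * n)" using s by (metis length_Suc_conv)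
      then show ?thesis using st'[of t] by (cases b) auto
    qed
    then show "\<exists>k. \<forall>s. length s = k \<longrightarrow> Q s \<subseteq> V n \<or> Q s \<inter> V n = {}" by blast
  qed
  then show ?thesis by blast
qed

theorem leg_structures_homeomorphic:
  assumes "leg_structure X v \<rho> U" "leg_structure Y w \<sigma> V"
  shows "\<exists>F G. homeomorphism X Y F G"
proof -
  interpret leg_structure_pair X v \<rho> U Y w \<sigma> V
    using assms by (simp add: leg_structure_pair_def)
  obtain P Q a where "matched_tree X v \<rho> U Y w \<sigma> V P Q a" using matched_tree_ex by blast
  then show ?thesis by (rule matched_tree.homeomorphic)
qed

section \<open>Arcs in smooth fans\<close>

lemma arc_in_sym: "arc_in X a b A \<Longrightarrow> arc_in X b a A"
  unfolding arc_in_def by (metis arc_reversepath path_image_reversepath pathfinish_reversepath pathstart_reversepath)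

lemma arc_in_subarc:
  assumes "arc g" "path_image g \<subseteq> X" "0 \<le> s" "s < t" "t \<le> 1"
  shows "arc_in X (g s) (g t) (g ` {s..t})"
proof -
  define k where "k u = (t - s) * u + s" for u
  have k: "k ` {0..1} = {s..t}"
    using image_affinity_atLeastAtMost[of "t - s" s 0 1] assms by (simp add: k_def[abs_def])
  have sub: "{s..t} \<subseteq> {0..1}" using assms by auto
  have g: "continuous_on {s..t} g" "inj_on g {s..t}"
    using assms(1) sub unfolding arc_def path_def by (meson continuous_on_subset inj_on_subset)+
  have "continuous_on {0..1} (g \<circ> k)"
    using g(1) unfolding k[symmetric] by (intro continuous_on_compose) (auto simp: k_def[abs_def] intro!: continuous_intros)
  moreover have "inj_on (g \<circ> k) {0..1}"
    using g(2) assms(4) unfolding k[symmetric] by (intro comp_inj_on) (simp_all add: k_def[abs_def] inj_on_def)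
  moreover have im: "path_image (g \<circ> k) = g ` {s..t}"
    unfolding path_image_def image_comp[symmetric] k ..
  moreover have "g ` {s..t} \<subseteq> X" using assms(2) sub unfolding path_image_def by blast
  moreover have "pathstart (g \<circ> k) = g s" "pathfinish (g \<circ> k) = g t"
    by (simp_all add: pathstart_def pathfinish_def k_def)
  ultimately show ?thesis unfolding arc_in_def arc_def path_def by blast
qed

lemma arc_in_imp_continuum: "arc_in X a b A \<Longrightarrow> continuum A"
  unfolding arc_in_def continuum_def
  by (metis arc_imp_path compact_path_image connected_path_image path_image_nonempty)

text \<open>Pulled back to the unit interval, \<open>S\<close> is a connected set that contains 0
  and 1.\<close>

lemma connected_in_arc_eq:
  fixes A :: "'a::metric_space set"
  assumes "arc_in X a b A" "connected S" "S \<subseteq> A" "a \<in> S" "b \<in> S"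
  shows "S = A"
proof -
  obtain g where g: "arc g" "pathstart g = a" "pathfinish g = b" "path_image g = A"
    using assms(1) unfolding arc_in_def by blast
  obtain h where h: "homeomorphism {0..1} A g h" using homeomorphism_arc[OF g(1)] g(4) by metis
  have "connected (h ` S)"
    using h assms(2,3) by (metis connected_continuous_image continuous_on_subset homeomorphism_cont2)
  moreover have "0 \<in> h ` S" "1 \<in> h ` S"
    using assms(4,5) g(2,3) h unfolding pathstart_def pathfinish_def
    by (metis atLeastAtMost_iff homeomorphism_apply1 imageI order_refl zero_le_one)+
  ultimately have "{0..1} \<subseteq> h ` S" using connected_contains_Icc by blast
  moreover have "g ` h ` S = S" using h assms(3) unfolding homeomorphism_def by force
  moreover have "g ` {0..1} = A" using h by (simp add: homeomorphism_def)
  ultimately show ?thesis using assms(3) by (metis image_mono subset_antisym)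
qed

locale smooth_fan_top =
  fixes X :: "'a::metric_space set" and v :: 'a
  assumes smooth: "smooth_fan_with_top X v"
begin

abbreviation seg :: "'a \<Rightarrow> 'a set" where "seg \<equiv> arc_from X v"

lemma fan_X: "fan X" and ramification_v: "ramification_point X v"
  using smooth unfolding smooth_fan_with_top_def by auto

lemma v_in: "v \<in> X"
  using ramification_v unfolding ramification_point_def by blast

lemma ramification_unique: "ramification_point X u \<Longrightarrow> u = v"
  using fan_X ramification_v unfolding fan_def by blast

lemma dendroid_X: "dendroid X"
  using fan_X unfolding fan_def by blast

lemma continuum_X: "continuum X"
  using dendroid_X unfolding dendroid_def by blast

lemma unicoherent: "\<lbrakk>K \<subseteq> X; M \<subseteq> X; continuum K; continuum M\<rbrakk> \<Longrightarrow> connected (K \<inter> M)"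
  using dendroid_X unfolding dendroid_def hereditarily_unicoherent_def by blast

lemma arcwise: "\<lbrakk>x \<in> X; y \<in> X; x \<noteq> y\<rbrakk> \<Longrightarrow> \<exists>A. arc_in X x y A"
  using dendroid_X unfolding dendroid_def arcwise_connected_def by blast

lemma compact_X: "compact X"
  using continuum_X unfolding continuum_def by blast

text \<open>Unicoherence makes \<open>K \<inter> A\<close> a connected subset of \<open>A\<close>
  containing both ends, hence all of \<open>A\<close>. With another arc as \<open>K\<close> this
  gives uniqueness of arcs.\<close>

lemma arc_in_subset_continuum:
  assumes A: "arc_in X a b A" and K: "K \<subseteq> X" "continuum K" "a \<in> K" "b \<in> K"
  shows "A \<subseteq> K"
proof -
  have AX: "A \<subseteq> X" and ab: "a \<in> A" "b \<in> A"
    using A unfolding arc_in_def by auto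
  have "connected (K \<inter> A)"
    using unicoherent[OF K(1) AX K(2)] arc_in_imp_continuum[OF A] by blast
  then have "K \<inter> A = A"
    by (rule connected_in_arc_eq[OF A]) (use K ab in auto)
  then show ?thesis by blast
qed

lemma arc_in_unique: "arc_in X a b A \<Longrightarrow> arc_in X a b B \<Longrightarrow> A = B"
  by (metis arc_in_subset_continuum arc_in_imp_continuum arc_in_def pathfinish_in_path_image
      pathstart_in_path_image subset_antisym)

lemma seg_eq: "arc_in X v x A \<Longrightarrow> seg x = A"
proof -
  assume A: "arc_in X v x A"
  then have "x \<noteq> v" unfolding arc_in_def using arc_distinct_ends by metis
  moreover have "(THE A. arc_in X v x A) = A" using A arc_in_unique by (intro the_equality) auto
  ultimately show ?thesis unfolding arc_from_def by simp
qed

lemma seg_v: "seg v = {v}"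
  by (simp add: arc_from_def)

text \<open>The clause on \<open>seg (g t)\<close> identifies the order of parameters with the order
  \<open>z \<in> seg x\<close>, so statements about this order reduce to intervals of
  numbers.\<close>

lemma seg_parametrization:
  assumes "x \<in> X" "x \<noteq> v"
  obtains g where "arc g" "path_image g \<subseteq> X" "g 0 = v" "g 1 = x" "seg x = g ` {0..1}"
    "\<forall>t\<in>{0..1}. seg (g t) = g ` {0..t}" "inj_on g {0..1}" "continuous_on {0..1} g"
proof -
  obtain A where "arc_in X v x A" using arcwise[OF v_in assms(1)] assms(2) by blast
  then obtain g where g: "arc g" "g 0 = v" "g 1 = x" "path_image g \<subseteq> X"
    unfolding arc_in_def pathstart_def pathfinish_def by blast
  have t: "seg (g t) = g ` {0..t}" if "0 \<le> t" "t \<le> 1" for t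
  proof (cases "t = 0")
    case True then show ?thesis using g seg_v by simp
  next
    case False
    then show ?thesis using seg_eq arc_in_subarc[OF g(1,4), of 0 t] that g by simp
  qed
  have "seg x = g ` {0..1}" using t[of 1] g(3) by simp
  moreover have "inj_on g {0..1}" "continuous_on {0..1} g" using g(1) unfolding arc_def path_def by auto
  ultimately show ?thesis using that[OF g(1,4,2,3)] t by fastforce
qed

lemma seg_continuum: "x \<in> X \<Longrightarrow> continuum (seg x)"
  and seg_subset: "x \<in> X \<Longrightarrow> seg x \<subseteq> X"
  and v_in_seg: "x \<in> X \<Longrightarrow> v \<in> seg x"
  and in_seg: "x \<in> X \<Longrightarrow> x \<in> seg x"
proof -
  have "continuum (seg x) \<and> seg x \<subseteq> X \<and> v \<in> seg x \<and> x \<in> seg x" if x: "x \<in> X"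
  proof (cases "x = v")
    case True
    then show ?thesis using x by (simp add: seg_v continuum_def)
  next
    case False
    then obtain A where A: "arc_in X v x A" using arcwise[OF v_in x] by blast
    then show ?thesis using seg_eq[OF A] arc_in_imp_continuum[OF A] unfolding arc_in_def by auto
  qed
  then show "x \<in> X \<Longrightarrow> continuum (seg x)" "x \<in> X \<Longrightarrow> seg x \<subseteq> X" "x \<in> X \<Longrightarrow> v \<in> seg x"
    "x \<in> X \<Longrightarrow> x \<in> seg x" by auto
qed

lemma seg_compact: "x \<in> X \<Longrightarrow> compact (seg x)" and seg_connected: "x \<in> X \<Longrightarrow> connected (seg x)"
  using seg_continuum unfolding continuum_def by auto

lemma seg_minimal:
  assumes "K \<subseteq> X" "continuum K" "v \<in> K" "x \<in> K"
  shows "seg x \<subseteq> K"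
proof (cases "x = v")
  case True then show ?thesis using assms by (simp add: seg_v)
next
  case False
  then obtain A where A: "arc_in X v x A" using arcwise[OF v_in] assms by blast
  then show ?thesis using seg_eq[OF A] arc_in_subset_continuum[OF A assms] by simp
qed

lemma seg_trans: "x \<in> X \<Longrightarrow> z \<in> seg x \<Longrightarrow> seg z \<subseteq> seg x"
  by (simp add: seg_minimal seg_continuum seg_subset v_in_seg)

lemma seg_antisym:
  assumes "x \<in> X" "z \<in> seg x" "x \<in> seg z"
  shows "x = z"
proof (cases "x = v")
  case True then show ?thesis using assms by (simp add: seg_v)
next
  case False
  obtain g where g: "arc g" "path_image g \<subseteq> X" "g 0 = v" "g 1 = x" "seg x = g ` {0..1}"
    "\<forall>t\<in>{0..1}. seg (g t) = g ` {0..t}" "inj_on g {0..1}" "continuous_on {0..1} g"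
    using seg_parametrization[OF assms(1) False] .
  obtain s where s: "0 \<le> s" "s \<le> 1" "z = g s" using assms(2) g(5) by auto
  then obtain t where "0 \<le> t" "t \<le> s" "g 1 = g t" using assms(3) g(4,6) by auto
  then have "t = 1" using inj_onD[OF g(7), of 1 t] s by auto
  then show ?thesis using s \<open>t \<le> s\<close> g(4) by auto
qed

lemma seg_linear:
  assumes "x \<in> X" "y \<in> seg x" "z \<in> seg x"
  shows "y \<in> seg z \<or> z \<in> seg y"
proof (cases "x = v")
  case True then show ?thesis using assms by (simp add: seg_v)
next
  case False
  obtain g where g: "arc g" "path_image g \<subseteq> X" "g 0 = v" "g 1 = x" "seg x = g ` {0..1}"
    "\<forall>t\<in>{0..1}. seg (g t) = g ` {0..t}" "inj_on g {0..1}" "continuous_on {0..1} g"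
    using seg_parametrization[OF assms(1) False] .
  obtain s where s: "0 \<le> s" "s \<le> 1" "y = g s" using assms(2) g(5) by auto
  obtain t where t: "0 \<le> t" "t \<le> 1" "z = g t" using assms(3) g(5) by auto
  show ?thesis using s t bspec[OF g(6), of s] bspec[OF g(6), of t] by (cases "s \<le> t") auto
qed

lemma connected_interval:
  assumes "x \<in> X" "z \<in> seg x"
  shows "connected {u \<in> seg x. z \<in> seg u}"
proof (cases "x = v")
  case True
  then have "{u \<in> seg x. z \<in> seg u} \<subseteq> {v}" by (auto simp: seg_v)
  then show ?thesis by (metis connected_empty connected_sing subset_singletonD)
next
  case False
  obtain g where g: "arc g" "path_image g \<subseteq> X" "g 0 = v" "g 1 = x" "seg x = g ` {0..1}"
    "\<forall>t\<in>{0..1}. seg (g t) = g ` {0..t}" "inj_on g {0..1}" "continuous_on {0..1} g"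
    using seg_parametrization[OF assms(1) False] .
  obtain s where s: "0 \<le> s" "s \<le> 1" "z = g s" using assms(2) g(5) by auto
  have iff: "z \<in> seg (g t) \<longleftrightarrow> s \<le> t" if "0 \<le> t" "t \<le> 1" for t
    using that s bspec[OF g(6), of t] inj_onD[OF g(7)] by force
  have "{u \<in> seg x. z \<in> seg u} = g ` {s..1}"
    using iff s unfolding g(5) by force
  then show ?thesis
    using s g(8) by (auto intro!: connected_continuous_image intro: continuous_on_subset)
qed

text \<open>The last point that the arc to \<open>x\<close> shares with \<open>seg y\<close> would
  be the centre of a triod with arms to \<open>v\<close>, \<open>x\<close> and \<open>y\<close>; but
  \<open>v\<close> is the only ramification point.\<close>

lemma incomparable_meet:
  assumes x: "x \<in> X" "x \<notin> seg y" and y: "y \<in> X" "y \<notin> seg x" and z: "z \<in> seg x" "z \<in> seg y"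
  shows "z = v"
proof (rule ccontr)
  assume "z \<noteq> v"
  have nv: "x \<noteq> v" "y \<noteq> v" using x y v_in_seg by metis+
  obtain g where g: "arc g" "path_image g \<subseteq> X" "g 0 = v" "g 1 = x" "seg x = g ` {0..1}"
    "\<forall>t\<in>{0..1}. seg (g t) = g ` {0..t}" "inj_on g {0..1}" "continuous_on {0..1} g"
    using seg_parametrization[OF x(1) nv(1)] .
  obtain h where h: "arc h" "path_image h \<subseteq> X" "h 0 = v" "h 1 = y" "seg y = h ` {0..1}"
    "\<forall>t\<in>{0..1}. seg (h t) = h ` {0..t}" "inj_on h {0..1}" "continuous_on {0..1} h"
    using seg_parametrization[OF y(1) nv(2)] .
  \<comment> \<open>Parameters at which the arc to \<open>x\<close> lies on \<open>seg y\<close>;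
    the arcs branch at the largest of them.\<close>
  define S where "S = {0..1} \<inter> g -` seg y"
  have "compact S"
    unfolding S_def using continuous_closed_preimage[OF g(8) closed_atLeastAtMost compact_imp_closed[OF seg_compact[OF y(1)]]]
    by (meson Int_lower1 compact_Icc compact_Int_closed compact_eq_bounded_closed bounded_subset)
  obtain s where s: "0 \<le> s" "s \<le> 1" "z = g s" using z g(5) by auto
  have "s \<in> S" using s z by (auto simp: S_def)
  obtain t where t: "t \<in> S" "\<And>u. u \<in> S \<Longrightarrow> u \<le> t"
    using compact_attains_sup[OF \<open>compact S\<close>] \<open>s \<in> S\<close> by blast
  have "s \<noteq> 0" using s \<open>z \<noteq> v\<close> g(3) by metis
  then have t0: "0 < t" using t(2)[OF \<open>s \<in> S\<close>] s by linarith
  have "t \<noteq> 1" using t(1) x(2) g(4) by (auto simp: S_def)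
  then have t1: "t < 1" using t(1) by (auto simp: S_def)
  obtain r where r: "0 \<le> r" "r \<le> 1" "g t = h r" using t(1) h(5) by (auto simp: S_def)
  have "r \<noteq> 1"
  proof
    assume "r = 1"
    then have "y = g t" using r h(4) by simp
    then show False using y(2) g(5) t0 t1 by auto
  qed
  then have r1: "r < 1" using r by linarith
  \<comment> \<open>Up to the branching both parametrizations trace the same set, which becomes the
    arm to \<open>v\<close>.\<close>
  have segt: "seg (g t) = g ` {0..t}" "seg (g t) = h ` {0..r}"
    using bspec[OF g(6), of t] bspec[OF h(6), of r] r t0 t1 by auto
  have "arc_in X (g t) v (g ` {0..t})"
    using arc_in_sym[OF arc_in_subarc[OF g(1,2), of 0 t]] t0 t1 g(3) by simp
  moreover have "arc_in X (g t) x (g ` {t..1})"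
    using arc_in_subarc[OF g(1,2), of t 1] t0 t1 g(4) by simp
  moreover have "arc_in X (g t) y (h ` {r..1})"
    using arc_in_subarc[OF h(1,2), of r 1] r r1 h(4) by simp
  moreover have "g ` {0..t} \<inter> g ` {t..1} = {g t}"
  proof -
    have "g ` {0..t} \<inter> g ` {t..1} = g ` ({0..t} \<inter> {t..1})"
      using t0 t1 by (intro inj_on_image_Int[OF g(7), symmetric]) auto
    also have "{0..t} \<inter> {t..1} = {t}" using t0 t1 by auto
    finally show ?thesis by simp
  qed
  moreover have "g ` {0..t} \<inter> h ` {r..1} = {g t}"
  proof -
    have "h ` {0..r} \<inter> h ` {r..1} = h ` ({0..r} \<inter> {r..1})"
      using r by (intro inj_on_image_Int[OF h(7), symmetric]) auto
    also have "{0..r} \<inter> {r..1} = {r}" using r by auto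
    finally show ?thesis using segt r by simp
  qed
  moreover have "g ` {t..1} \<inter> h ` {r..1} = {g t}"
  proof -
    have "u = t" if "u \<in> {t..1}" "g u \<in> h ` {r..1}" for u
    proof -
      have "h ` {r..1} \<subseteq> seg y" using h(5) r by auto
      then have "u \<in> S" using that t0 by (auto simp: S_def)
      then show ?thesis using t(2)[of u] that by simp
    qed
    moreover have "g t \<in> g ` {t..1}" using t1 by auto
    moreover have "g t \<in> h ` {r..1}" using r(2) unfolding r(3) by auto
    ultimately show ?thesis by blast
  qed
  moreover have "g t \<in> X" using t0 t1 g(2) unfolding path_image_def by auto
  ultimately have "ramification_point X (g t)"
    unfolding ramification_point_def by blast
  then have "g t = g 0" using ramification_unique g(3) by simp
  then show False using inj_onD[OF g(7)] t0 t1 by force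
qed

text \<open>For incomparable points \<open>seg x \<union> seg y\<close> is a continuum whose two
  arcs meet only in \<open>v\<close>. Unicoherence makes its trace on \<open>S\<close> connected,
  although that trace misses \<open>v\<close> and meets both arcs.\<close>

lemma continuum_one_leg:
  assumes S: "S \<subseteq> X" "continuum S" "v \<notin> S" and xy: "x \<in> S" "y \<in> S"
  shows "x \<in> seg y \<or> y \<in> seg x"
proof (rule ccontr)
  assume inc: "\<not> (x \<in> seg y \<or> y \<in> seg x)"
  have X: "x \<in> X" "y \<in> X" using S xy by auto
  have meet: "seg x \<inter> seg y = {v}"
    using incomparable_meet[of x y] inc X v_in_seg by blast
  have "continuum (seg x \<union> seg y)"
    unfolding continuum_def using X seg_compact seg_connected meet
    by (auto intro!: connected_Un compact_Un simp: v_in_seg)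
  then have "connected (S \<inter> (seg x \<union> seg y))"
    using unicoherent[OF S(1) _ S(2)] X seg_subset by auto
  moreover have "seg x \<inter> seg y \<inter> (S \<inter> (seg x \<union> seg y)) = {}" using meet S(3) by auto
  moreover have "closed (seg x)" "closed (seg y)" using X seg_compact compact_imp_closed by blast+
  ultimately have "seg x \<inter> (S \<inter> (seg x \<union> seg y)) = {} \<or> seg y \<inter> (S \<inter> (seg x \<union> seg y)) = {}"
    by (intro connected_closedD) auto
  then show False using xy in_seg[OF X(1)] in_seg[OF X(2)] by blast
qed

text \<open>If \<open>v \<notin> S\<close>, then \<open>S \<union> seg x\<close> is a continuum
  joining \<open>v\<close> to \<open>y\<close>, so it contains \<open>seg y\<close>; and a point of
  \<open>seg x\<close> that is not below \<open>x\<close> can only be \<open>x\<close>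
  itself.\<close>

lemma continuum_order_convex:
  assumes S: "S \<subseteq> X" "continuum S" and "x \<in> S" "y \<in> S" "x \<in> seg z" "z \<in> seg y"
  shows "z \<in> S"
proof (cases "v \<in> S")
  case True
  then show ?thesis using seg_minimal[OF S True] assms by blast
next
  case False
  have X: "x \<in> X" "y \<in> X" "z \<in> X" using assms seg_subset by blast+
  have "continuum (S \<union> seg x)"
    using S X seg_compact seg_connected in_seg[OF X(1)] \<open>x \<in> S\<close> unfolding continuum_def
    by (auto intro!: connected_Un compact_Un)
  then have "seg y \<subseteq> S \<union> seg x"
    using seg_minimal[of "S \<union> seg x" y] S X seg_subset v_in_seg assms by blast
  then show ?thesis using assms seg_antisym[of z x] X by blast
qed

text \<open>Points of \<open>X - {v}\<close> lie on the same leg iff they are comparable.\<close>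
definition comparable :: "'a \<Rightarrow> 'a \<Rightarrow> bool" where
  "comparable x y \<longleftrightarrow> x \<in> seg y \<or> y \<in> seg x"

text \<open>Otherwise \<open>e\<close> would be an interior point of the arc from \<open>v\<close>
  to \<open>x\<close>.\<close>

lemma end_point_maximal:
  assumes "e \<in> end_points X" "x \<in> X" "e \<noteq> v" "e \<in> seg x"
  shows "x = e"
proof (rule ccontr)
  assume "x \<noteq> e"
  have "x \<noteq> v" using assms by (auto simp: seg_v)
  then obtain A where A: "arc_in X v x A" using arcwise[OF v_in assms(2)] by blast
  then have "e \<in> A" using seg_eq[OF A] assms by simp
  then show False using assms A \<open>x \<noteq> e\<close> unfolding end_points_def by blast
qed

lemma smooth_limit:
  "\<lbrakk>x \<in> X; \<And>n. s n \<in> X; s \<longlonglongrightarrow> x\<rbrakk> \<Longrightarrow> (\<lambda>n. hausdorff_dist (seg (s n)) (seg x)) \<longlonglongrightarrow> 0"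
  using smooth unfolding smooth_fan_with_top_def by blast

end

section \<open>Radial functions and separation of legs\<close>

lemma hausdorff_dist_lessD:
  fixes A B :: "'a::metric_space set"
  assumes "compact A" "compact B" "A \<noteq> {}" "B \<noteq> {}" "hausdorff_dist A B < \<delta>"
  shows "\<forall>a\<in>A. \<exists>b\<in>B. dist a b < \<delta>" "\<forall>b\<in>B. \<exists>a\<in>A. dist b a < \<delta>"
proof -
  have one: "\<forall>a\<in>A. \<exists>b\<in>B. dist a b < \<delta>"
    if "compact A" "B \<noteq> {}" "(SUP a\<in>A. infdist a B) < \<delta>" for A B :: "'a set"
  proof
    fix a assume "a \<in> A"
    have "bdd_above ((\<lambda>a. infdist a B) ` A)"
      by (intro bounded_imp_bdd_above compact_imp_bounded compact_continuous_image that continuous_intros)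
    then have "infdist a B \<le> (SUP a\<in>A. infdist a B)" using \<open>a \<in> A\<close> by (rule cSUP_upper2) auto
    then have "(INF b\<in>B. dist a b) < \<delta>" using that(2,3) by (simp add: infdist_notempty)
    then show "\<exists>b\<in>B. dist a b < \<delta>" using that(2) by (subst (asm) cINF_less_iff) auto
  qed
  show "\<forall>a\<in>A. \<exists>b\<in>B. dist a b < \<delta>" "\<forall>b\<in>B. \<exists>a\<in>A. dist b a < \<delta>"
    using one[of A B] one[of B A] assms unfolding hausdorff_dist_def by simp_all
qed

lemma hausdorff_dist_leI:
  fixes A B :: "'a::metric_space set"
  assumes "A \<noteq> {}" "B \<noteq> {}" "\<And>a. a \<in> A \<Longrightarrow> \<exists>b\<in>B. dist a b \<le> \<delta>" "\<And>b. b \<in> B \<Longrightarrow> \<exists>a\<in>A. dist b a \<le> \<delta>"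
  shows "hausdorff_dist A B \<le> \<delta>"
proof -
  have "infdist a B \<le> \<delta>" if "a \<in> A" for a using assms(3)[OF that] infdist_le2 by blast
  moreover have "infdist b A \<le> \<delta>" if "b \<in> B" for b using assms(4)[OF that] infdist_le2 by blast
  ultimately show ?thesis
    unfolding hausdorff_dist_def using assms(1,2) by (auto intro!: cSUP_least)
qed

lemma hausdorff_dist_nonneg:
  fixes A B :: "'a::metric_space set"
  assumes "compact A" "A \<noteq> {}"
  shows "0 \<le> hausdorff_dist A B"
proof -
  obtain a where a: "a \<in> A" using assms by blast
  have "bdd_above ((\<lambda>a. infdist a B) ` A)"
    by (intro bounded_imp_bdd_above compact_imp_bounded compact_continuous_image assms continuous_intros)
  then have "infdist a B \<le> (SUP a\<in>A. infdist a B)" using a by (rule cSUP_upper2) auto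
  then show ?thesis using infdist_nonneg[of a B] unfolding hausdorff_dist_def by linarith
qed

lemma infdist_le_add:
  fixes A B :: "'a::metric_space set"
  assumes "A \<noteq> {}" "\<And>a. a \<in> A \<Longrightarrow> \<exists>b\<in>B. dist a b \<le> \<delta>"
  shows "infdist p B \<le> infdist p A + \<delta>"
proof -
  have "infdist p B - \<delta> \<le> (INF a\<in>A. dist p a)"
  proof (rule cINF_greatest[OF assms(1)])
    fix a assume "a \<in> A"
    then obtain b where "b \<in> B" "dist a b \<le> \<delta>" using assms(2) by blast
    then show "infdist p B - \<delta> \<le> dist p a"
      using infdist_le[of b B p] dist_triangle[of p b a] by linarith
  qed
  then show ?thesis using assms(1) by (simp add: infdist_notempty)
qed

lemma compact_dense_sequence:
  fixes X :: "'a::metric_space set"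
  assumes "compact X" "X \<noteq> {}"
  shows "\<exists>q :: nat \<Rightarrow> 'a. (\<forall>n. q n \<in> X) \<and> (\<forall>x\<in>X. \<forall>e>0. \<exists>n. dist (q n) x < e)"
proof -
  have "\<forall>m::nat. \<exists>k. finite k \<and> k \<subseteq> X \<and> X \<subseteq> (\<Union>x\<in>k. ball x (1 / Suc m))"
    using seq_compact_imp_totally_bounded[OF compact_imp_seq_compact[OF assms(1)]] by simp
  then obtain k where k: "\<And>m::nat. finite (k m)" "\<And>m. k m \<subseteq> X" "\<And>m. X \<subseteq> (\<Union>x\<in>k m. ball x (1 / Suc m))"
    by metis
  define D where "D = (\<Union>m. k m)"
  have D: "countable D" "D \<noteq> {}" "D \<subseteq> X"
  proof -
    show "countable D" unfolding D_def using k(1) by (intro countable_UN) (auto intro: countable_finite)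
    show "D \<noteq> {}" using k(3)[of 0] assms(2) by (auto simp: D_def)
    show "D \<subseteq> X" using k(2) by (auto simp: D_def)
  qed
  have dense: "\<exists>n. dist (from_nat_into D n) x < e" if "x \<in> X" "0 < e" for x e
  proof -
    obtain m where "inverse (real (Suc m)) < e" using reals_Archimedean \<open>0 < e\<close> by blast
    moreover obtain d where "d \<in> k m" "dist d x < 1 / Suc m" using k(3)[of m] \<open>x \<in> X\<close> by auto
    ultimately have "d \<in> D" "dist d x < e" by (auto simp: D_def inverse_eq_divide)
    then show ?thesis using D by (metis from_nat_into_surj)
  qed
  have "from_nat_into D n \<in> X" for n using D(3) from_nat_into[OF D(2)] by blast
  then show ?thesis using dense by (intro exI[of _ "from_nat_into D"]) blast
qed

text \<open>In a compact Hausdorff space quasi-components are components, so points that no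
  connected set joins are separated by clopen sets; compactness of \<open>A\<close> and
  \<open>B\<close> extends this from points to sets.\<close>

lemma compact_clopen_separation:
  fixes S :: "'a::metric_space set"
  assumes S: "compact S" and A: "compact A" "A \<subseteq> S" and B: "compact B" "B \<subseteq> S"
    and conn: "\<And>C. \<lbrakk>connected C; compact C; C \<subseteq> S\<rbrakk> \<Longrightarrow> C \<inter> A = {} \<or> C \<inter> B = {}"
  shows "\<exists>T. openin (top_of_set S) T \<and> closedin (top_of_set S) T \<and> A \<subseteq> T \<and> T \<inter> B = {}"
proof -
  let ?X = "top_of_set S"
  have cS: "compact_space ?X" using S compact_space_subtopology by (metis compactin_euclidean_iff)
  have hS: "Hausdorff_space ?X" by (simp add: Hausdorff_space_subtopology)
  have "separated_between ?X {a} {b}" if "a \<in> A" "b \<in> B" for a b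
  proof -
    have "\<not> connected_component_of ?X a b"
    proof
      assume ab: "connected_component_of ?X a b"
      let ?C = "connected_component_of_set ?X a"
      have "closedin ?X ?C" by (rule closedin_connected_component_of)
      then have "compact ?C" using S closedin_compact by blast
      moreover have "connected ?C" "?C \<subseteq> S"
        using connectedin_connected_component_of[of ?X a] by (auto simp: connectedin_subtopology)
      moreover have "a \<in> ?C" "b \<in> ?C"
        using ab A that connected_component_of_refl[of ?X a] by auto
      ultimately show False using conn that by blast
    qed
    moreover have "quasi_component_of ?X a = connected_component_of ?X a"
      using cS hS by (intro quasi_eq_connected_component_of) auto
    ultimately show ?thesis using that A B by (auto simp: separated_between_singletons)
  qed
  moreover have "compactin ?X A" "compactin ?X B" using A B by (auto simp: compactin_subtopology)
  ultimately have "separated_between ?X A B"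
    using A B by (auto simp: separated_between_pointwise_left separated_between_pointwise_right)
  then show ?thesis
    unfolding separated_between by blast
qed

section \<open>Whitney functions and clopen separation in a smooth fan\<close>

context smooth_fan_top
begin

lemma X_nonempty: "X \<noteq> {}"
  using v_in by blast

text \<open>The value depends on \<open>seg x\<close> only through its image under \<open>f\<close>;
  this is what lets the function descend to the image space of a monotone map. Continuity comes from
  smoothness of the fan and uniform continuity of \<open>f\<close>.\<close>

lemma radial_function:
  fixes f :: "'a \<Rightarrow> 'b::metric_space"
  assumes f: "continuous_on X f"
  shows "\<exists>h :: 'a \<Rightarrow> real. continuous_on X h \<and> h v = 0 \<and>
    (\<forall>x\<in>X. \<forall>z\<in>X. f ` seg z \<subseteq> f ` seg x \<longrightarrow> h z \<le> h x) \<and>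
    (\<forall>x\<in>X. \<forall>z\<in>X. f ` seg z \<subset> f ` seg x \<longrightarrow> h z < h x)"
proof -
  obtain q :: "nat \<Rightarrow> 'a" where q: "\<And>n. q n \<in> X" "\<And>x e. x \<in> X \<Longrightarrow> 0 < e \<Longrightarrow> \<exists>n. dist (q n) x < e"
    using compact_dense_sequence[OF compact_X X_nonempty] by metis
  \<comment> \<open>A larger image is closer to each sample point \<open>f (q n)\<close>.
    Subtracting the distance from \<open>dist (f v) (f (q n))\<close> makes all terms nonnegative
    and makes them vanish at \<open>v\<close>, since \<open>seg v\<close> is
    \<open>{v}\<close>.\<close>
  define tm where "tm x n = (1/2) ^ n * (dist (f v) (f (q n)) - infdist (f (q n)) (f ` seg x))" for x n
  define h where "h x = (\<Sum>n. tm x n)" for x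
  obtain D where D: "\<And>x y. x \<in> f ` X \<Longrightarrow> y \<in> f ` X \<Longrightarrow> dist x y \<le> D"
    using compact_imp_bounded[OF compact_continuous_image[OF f compact_X]] unfolding bounded_two_points by blast
  have ge0: "0 \<le> dist (f v) (f (q n)) - infdist (f (q n)) (f ` seg x)" if "x \<in> X" for x n
    using infdist_le[of "f v" "f ` seg x" "f (q n)"] v_in_seg[OF that] by (simp add: dist_commute)
  have summ: "summable (tm x)" if "x \<in> X" for x
  proof (rule summable_comparison_test)
    show "\<exists>N. \<forall>n\<ge>N. norm (tm x n) \<le> (1/2) ^ n * D"
    proof (intro exI allI impI)
      fix n
      have "dist (f v) (f (q n)) - infdist (f (q n)) (f ` seg x) \<le> D"
        using D[of "f v" "f (q n)"] v_in q infdist_nonneg[of "f (q n)" "f ` seg x"] by fastforce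
      then show "norm (tm x n) \<le> (1/2) ^ n * D"
        using ge0[OF that, of n] unfolding tm_def by (simp add: abs_mult mult_left_mono)
    qed
    show "summable (\<lambda>n. (1/2) ^ n * D)" by (intro summable_mult2 summable_geometric) simp
  qed
  have tm_le: "tm z n \<le> tm x n" if "x \<in> X" "z \<in> X" "f ` seg z \<subseteq> f ` seg x" for x z n
    unfolding tm_def using infdist_mono[OF that(3)] v_in_seg[OF that(2)]
    by (intro mult_left_mono) auto
  have cont: "continuous_on X h"
    unfolding continuous_on_sequentially
  proof (intro allI ballI impI)
    fix s x assume x: "x \<in> X" and "(\<forall>n. s n \<in> X) \<and> s \<longlonglongrightarrow> x"
    then have s: "\<And>n. s n \<in> X" "s \<longlonglongrightarrow> x" by auto
    show "(h \<circ> s) \<longlonglongrightarrow> h x"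
      unfolding lim_sequentially
    proof (intro allI impI)
      fix \<epsilon> :: real assume "\<epsilon> > 0"
      \<comment> \<open>The weights \<open>(1/2) ^ k\<close> sum to 2, so a relative error of
        \<open>\<epsilon> / 4\<close> in each term gives a total of at most
        \<open>\<epsilon> / 2\<close>.\<close>
      then have e4: "\<epsilon> / 4 > 0" by simp
      obtain \<delta> where \<delta>: "\<delta> > 0" "\<And>a b. \<lbrakk>a \<in> X; b \<in> X; dist b a < \<delta>\<rbrakk> \<Longrightarrow> dist (f b) (f a) < \<epsilon> / 4"
        using compact_uniformly_continuous[OF f compact_X] e4 unfolding uniformly_continuous_on_def by metis
      obtain N where N: "\<And>n. n \<ge> N \<Longrightarrow> hausdorff_dist (seg (s n)) (seg x) < \<delta>"
        using order_tendstoD(2)[OF smooth_limit[OF x s] \<delta>(1)] unfolding eventually_sequentially by blast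
      have "dist (h (s n)) (h x) < \<epsilon>" if "n \<ge> N" for n
      proof -
        have c: "compact (seg (s n))" "compact (seg x)" "seg (s n) \<noteq> {}" "seg x \<noteq> {}"
          using seg_compact s x v_in_seg by blast+
        note H = hausdorff_dist_lessD[OF c N[OF that]]
        have H1: "\<exists>b\<in>f ` seg x. dist a b \<le> \<epsilon> / 4" if a: "a \<in> f ` seg (s n)" for a
        proof -
          obtain a' where a': "a = f a'" "a' \<in> seg (s n)" using a by blast
          then obtain b' where "b' \<in> seg x" "dist a' b' < \<delta>" using H(1) by blast
          then show ?thesis using a' \<delta>(2)[of b' a'] seg_subset s x by (meson imageI less_imp_le subsetD)
        qed
        have H2: "\<exists>b\<in>f ` seg (s n). dist a b \<le> \<epsilon> / 4" if a: "a \<in> f ` seg x" for a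
        proof -
          obtain a' where a': "a = f a'" "a' \<in> seg x" using a by blast
          then obtain b' where "b' \<in> seg (s n)" "dist a' b' < \<delta>" using H(2) by blast
          then show ?thesis using a' \<delta>(2)[of b' a'] seg_subset s x by (meson imageI less_imp_le subsetD)
        qed
        have le: "\<bar>tm (s n) k - tm x k\<bar> \<le> (1/2) ^ k * (\<epsilon> / 4)" for k
        proof -
          have ne: "f ` seg x \<noteq> {}" "f ` seg (s n) \<noteq> {}" using c by auto
          have "\<bar>infdist (f (q k)) (f ` seg x) - infdist (f (q k)) (f ` seg (s n))\<bar> \<le> \<epsilon> / 4"
            using infdist_le_add[OF ne(1) H2, of "f (q k)"] infdist_le_add[OF ne(2) H1, of "f (q k)"]
            by linarith
          then have "\<bar>(1/2) ^ k * (infdist (f (q k)) (f ` seg x) - infdist (f (q k)) (f ` seg (s n)))\<bar>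
              \<le> (1/2) ^ k * (\<epsilon> / 4)"
            by (simp only: abs_mult) (simp add: mult_left_mono)
          then show ?thesis unfolding tm_def by (simp add: algebra_simps)
        qed
        have sg: "summable (\<lambda>k. (1/2) ^ k * (\<epsilon> / 4))" by (intro summable_mult2 summable_geometric) simp
        have sa: "summable (\<lambda>k. \<bar>tm (s n) k - tm x k\<bar>)"
          by (rule summable_comparison_test[OF _ sg]) (use le in auto)
        have "dist (h (s n)) (h x) = \<bar>\<Sum>k. tm (s n) k - tm x k\<bar>"
          unfolding h_def dist_real_def by (simp add: suminf_diff summ s x)
        also have "\<dots> \<le> (\<Sum>k. \<bar>tm (s n) k - tm x k\<bar>)"
          by (rule summable_rabs[OF sa])
        also have "\<dots> \<le> (\<Sum>k. (1/2) ^ k * (\<epsilon> / 4))"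
          by (rule suminf_le[OF le sa sg])
        also have "\<dots> = 2 * (\<epsilon> / 4)"
          using suminf_mult2[OF summable_geometric[of "1/2::real"], of "\<epsilon> / 4"] suminf_geometric[of "1/2::real"] by simp
        also have "\<dots> < \<epsilon>" using \<open>\<epsilon> > 0\<close> by simp
        finally show ?thesis .
      qed
      then show "\<exists>N. \<forall>n\<ge>N. dist ((h \<circ> s) n) (h x) < \<epsilon>" by auto
    qed
  qed
  have zero: "h v = 0"
    unfolding h_def tm_def by (simp add: seg_v dist_commute)
  have mono: "h z \<le> h x" if "x \<in> X" "z \<in> X" "f ` seg z \<subseteq> f ` seg x" for x z
    unfolding h_def using tm_le[OF that] summ that by (intro suminf_le) auto
  have strict: "h z < h x" if xz: "x \<in> X" "z \<in> X" "f ` seg z \<subset> f ` seg x" for x z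
  proof -
    obtain u where u: "u \<in> seg x" "f u \<notin> f ` seg z" using xz(3) by blast
    have uX: "u \<in> X" using u seg_subset xz by blast
    have cz: "compact (f ` seg z)" "f ` seg z \<noteq> {}"
      using compact_continuous_image[OF continuous_on_subset[OF f seg_subset[OF xz(2)]] seg_compact[OF xz(2)]] v_in_seg[OF xz(2)] by auto
    define \<delta> where "\<delta> = infdist (f u) (f ` seg z)"
    have "\<delta> > 0" unfolding \<delta>_def using infdist_pos_not_in_closed[OF compact_imp_closed[OF cz(1)] cz(2) u(2)] .
    then obtain d where d: "d > 0" "\<And>y. \<lbrakk>y \<in> X; dist y u < d\<rbrakk> \<Longrightarrow> dist (f y) (f u) < \<delta> / 3"
      using f uX unfolding continuous_on_iff by (metis divide_pos_pos zero_less_numeral)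
    \<comment> \<open>This sample point is within \<open>\<delta> / 3\<close> of the image of
      \<open>seg x\<close> but farther than that from the image of \<open>seg z\<close>, so one term
      is strictly larger.\<close>
    obtain n where n: "dist (f (q n)) (f u) < \<delta> / 3" using q d uX by metis
    have "infdist (f (q n)) (f ` seg x) < \<delta> / 3"
      using infdist_le[of "f u" "f ` seg x" "f (q n)"] u n by auto
    moreover have "infdist (f (q n)) (f ` seg z) > \<delta> / 3"
      using infdist_triangle[of "f u" "f ` seg z" "f (q n)"] n \<open>\<delta> > 0\<close> unfolding \<delta>_def by (simp add: dist_commute)
    ultimately have n_less: "0 < tm x n - tm z n"
      unfolding tm_def right_diff_distrib[symmetric] by simp
    have "0 < (\<Sum>k. tm x k - tm z k)"
      by (rule suminf_pos2[OF summable_diff[OF summ[OF xz(1)] summ[OF xz(2)]] _ n_less])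
        (use tm_le[OF xz(1,2)] xz(3) in auto)
    then show ?thesis unfolding h_def using suminf_diff[OF summ[OF xz(1)] summ[OF xz(2)]] by simp
  qed
  show ?thesis using cont zero mono strict by (intro exI[of _ h]) blast
qed

text \<open>The part of the leg between the two points is nowhere lower than the lower one. When
  both heights are positive it avoids the top, so clopen sets off the top cannot separate comparable
  points.\<close>

lemma comparable_connected:
  assumes \<rho>: "\<And>x z. \<lbrakk>x \<in> X; z \<in> seg x\<rbrakk> \<Longrightarrow> \<rho> z \<le> (\<rho> x :: real)"
    and "a \<in> X" "b \<in> X" "comparable a b"
  shows "\<exists>I. connected I \<and> a \<in> I \<and> b \<in> I \<and> I \<subseteq> {u \<in> X. min (\<rho> a) (\<rho> b) \<le> \<rho> u}"
proof -
  have *: "\<exists>I. connected I \<and> a \<in> I \<and> b \<in> I \<and> I \<subseteq> {u \<in> X. \<rho> a \<le> \<rho> u}" if "b \<in> X" "a \<in> seg b" for a b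
  proof -
    have sub: "seg b \<subseteq> X" using seg_subset that by blast
    then have "{u \<in> seg b. a \<in> seg u} \<subseteq> {u \<in> X. \<rho> a \<le> \<rho> u}" using \<rho> by blast
    moreover have "a \<in> {u \<in> seg b. a \<in> seg u}" "b \<in> {u \<in> seg b. a \<in> seg u}"
      using that in_seg sub by blast+
    ultimately show ?thesis using connected_interval[OF that] by blast
  qed
  consider "a \<in> seg b" | "b \<in> seg a" using assms(4) unfolding comparable_def by blast
  then show ?thesis
  proof cases
    case 1
    have "min (\<rho> a) (\<rho> b) = \<rho> a" using \<rho>[OF assms(3) 1] by simp
    then show ?thesis using *[OF assms(3) 1] by simp
  next
    case 2
    have "min (\<rho> a) (\<rho> b) = \<rho> b" using \<rho>[OF assms(2) 2] by simp
    then show ?thesis using *[OF assms(2) 2] by (simp add: conj_ac)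
  qed
qed

text \<open>Legs can be arbitrarily short, so no single compact set \<open>{z \<in> X. c \<le> \<rho> z}\<close> sees them all: the separation
  is found there for one \<open>c\<close> and then extended step by step as \<open>c\<close> tends to 0.\<close>
lemma leg_clopen_separation:
  assumes cont: "continuous_on X \<rho>" and \<rho>v: "\<rho> v = (0::real)"
    and pos: "\<And>x. x \<in> X - {v} \<Longrightarrow> 0 < \<rho> x" and mono: "\<And>x z. \<lbrakk>x \<in> X; z \<in> seg x\<rbrakk> \<Longrightarrow> \<rho> z \<le> \<rho> x"
    and x: "x \<in> X - {v}" and y: "y \<in> X - {v}" and inc: "\<not> comparable x y"
  shows "\<exists>W. openin (top_of_set (X - {v})) W \<and> closedin (top_of_set (X - {v})) W \<and> x \<in> W \<and> y \<notin> W"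
proof -
  define \<delta> where "\<delta> = min (\<rho> x) (\<rho> y)"
  have \<delta>: "0 < \<delta>" "\<delta> \<le> \<rho> x" "\<delta> \<le> \<rho> y" using pos[OF x] pos[OF y] by (auto simp: \<delta>_def)
  \<comment> \<open>Starting at the smaller of the two heights puts both \<open>x\<close> and
    \<open>y\<close> into \<open>K 0\<close>.\<close>
  define c where "c n = \<delta> / 2 ^ n" for n :: nat
  have c: "0 < c n" "c (Suc n) \<le> c n" for n using \<delta> by (auto simp: c_def field_simps)
  define K where "K n = {z \<in> X. c n \<le> \<rho> z}" for n
  have K_Suc: "K n \<subseteq> K (Suc n)" for n using c(2)[of n] by (auto simp: K_def)
  have vK: "v \<notin> K n" for n using c(1)[of n] \<rho>v by (auto simp: K_def)
  have comK: "compact (K n)" for n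
  proof -
    have "K n = X \<inter> \<rho> -` {c n..}" by (auto simp: K_def)
    moreover have "closed (X \<inter> \<rho> -` {c n..})"
      by (rule continuous_closed_preimage[OF cont compact_imp_closed[OF compact_X] closed_atLeast])
    ultimately show ?thesis using compact_X by (metis Int_lower1 closed_Int_compact inf.absorb_iff1)
  qed
  have one_leg: "comparable a b" if "connected C" "compact C" "C \<subseteq> K n" "a \<in> C" "b \<in> C" for C n a b
    using continuum_one_leg[of C a b] that vK[of n] unfolding comparable_def continuum_def K_def by blast
  define clop where "clop n Q \<longleftrightarrow> openin (top_of_set (K n)) Q \<and> closedin (top_of_set (K n)) Q" for n Q
  have clopK: "Q \<subseteq> K n" "compact Q" "compact (K n - Q)" if "clop n Q" for n Q
  proof -
    show "Q \<subseteq> K n" using that openin_imp_subset unfolding clop_def by blast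
    show "compact Q" using that closedin_compact[OF comK] unfolding clop_def by blast
    have "closedin (top_of_set (K n)) (K n - Q)"
      using that unfolding clop_def by (metis closedin_diff closedin_topspace topspace_euclidean_subtopology)
    then show "compact (K n - Q)" using closedin_compact[OF comK] by blast
  qed
  \<comment> \<open>Each \<open>Q (Suc n)\<close> extends \<open>Q n\<close> without altering it on
    \<open>K n\<close>, so the union has a clopen trace on every \<open>K n\<close>.\<close>
  have "\<exists>Q. \<forall>n. (clop n (Q n) \<and> x \<in> Q n \<and> y \<notin> Q n) \<and> Q (Suc n) \<inter> K n = Q n"
  proof (rule dependent_nat_choice)
    have xy: "{x} \<subseteq> K 0" "{y} \<subseteq> K 0" using x y \<delta> by (auto simp: K_def c_def)
    have "C \<inter> {x} = {} \<or> C \<inter> {y} = {}" if "connected C" "compact C" "C \<subseteq> K 0" for C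
      using one_leg[OF that, of x y] inc by blast
    then show "\<exists>Q. clop 0 Q \<and> x \<in> Q \<and> y \<notin> Q"
      using compact_clopen_separation[OF comK _ xy(1) _ xy(2)] unfolding clop_def by auto
  next
    fix Q n assume Q: "clop n Q \<and> x \<in> Q \<and> y \<notin> Q"
    then have q: "clop n Q" by blast
    \<comment> \<open>A continuum in the larger set cannot join \<open>Q\<close> to
      \<open>K n - Q\<close>: two such points are on one leg, and the leg between them stays at
      height \<open>c n\<close> or more, hence in \<open>K n\<close>, where \<open>Q\<close> is
      clopen.\<close>
    have "C \<inter> Q = {} \<or> C \<inter> (K n - Q) = {}" if C: "connected C" "compact C" "C \<subseteq> K (Suc n)" for C
    proof (rule ccontr)
      assume "\<not> (C \<inter> Q = {} \<or> C \<inter> (K n - Q) = {})"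
      then obtain a b where ab: "a \<in> C" "a \<in> Q" "b \<in> C" "b \<in> K n - Q" by blast
      have abX: "a \<in> X" "b \<in> X" "c n \<le> \<rho> a" "c n \<le> \<rho> b" using ab clopK(1)[OF q] by (auto simp: K_def)
      have "\<exists>I. connected I \<and> a \<in> I \<and> b \<in> I \<and> I \<subseteq> {u \<in> X. min (\<rho> a) (\<rho> b) \<le> \<rho> u}"
        by (rule comparable_connected[OF mono abX(1,2) one_leg[OF C ab(1,3)]])
      then obtain I where I: "connected I" "a \<in> I" "b \<in> I" "I \<subseteq> {u \<in> X. min (\<rho> a) (\<rho> b) \<le> \<rho> u}"
        by auto
      have IK: "I \<subseteq> K n" using I(4) abX(3,4) by (auto simp: K_def)
      have "closed Q" "closed (K n - Q)" using clopK[OF q] compact_imp_closed by auto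
      then have "Q \<inter> I = {} \<or> (K n - Q) \<inter> I = {}"
        using connected_closedD[OF I(1), of Q "K n - Q"] IK by blast
      then show False using I(2,3) ab by blast
    qed
    then obtain T where T: "clop (Suc n) T" "Q \<subseteq> T" "T \<inter> (K n - Q) = {}"
      using compact_clopen_separation[OF comK[of "Suc n"] clopK(2)[OF q] _ clopK(3)[OF q]] clopK(1)[OF q] K_Suc[of n]
      unfolding clop_def by (metis (no_types, lifting) Diff_subset order_trans)
    have "y \<in> K n" using y \<delta> by (auto simp: K_def c_def field_simps intro: order_trans)
    then show "\<exists>T. (clop (Suc n) T \<and> x \<in> T \<and> y \<notin> T) \<and> T \<inter> K n = Q"
      using T Q clopK(1)[OF q] by (intro exI[of _ T]) blast
  qed
  then obtain Q where Q: "\<And>n. clop n (Q n)" "\<And>n. x \<in> Q n" "\<And>n. y \<notin> Q n" "\<And>n. Q (Suc n) \<inter> K n = Q n"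
    by blast
  define W where "W = (\<Union>n. Q n)"
  have QQ: "Q m \<inter> K n = Q n" if "n \<le> m" for m n
    using that
  proof (induction m rule: dec_induct)
    case base then show ?case using clopK(1)[OF Q(1)] by blast
  next
    case (step m)
    have "K n \<subseteq> K m" using step(1) K_Suc by (rule lift_Suc_mono_le[rotated])
    then have "Q (Suc m) \<inter> K n = Q m \<inter> K n" using Q(4)[of m] by blast
    then show ?case using step by simp
  qed
  have WK: "W \<inter> K n = Q n" for n
  proof
    show "W \<inter> K n \<subseteq> Q n"
    proof
      fix z assume z: "z \<in> W \<inter> K n"
      then obtain m where m: "z \<in> Q m" by (auto simp: W_def)
      show "z \<in> Q n"
      proof (cases "n \<le> m")
        case True then show ?thesis using QQ[OF True] m z by blast
      next
        case False then show ?thesis using QQ[of m n] m by auto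
      qed
    qed
    show "Q n \<subseteq> W \<inter> K n" using clopK(1)[OF Q(1)] by (auto simp: W_def)
  qed
  have W_sub: "W \<subseteq> X - {v}" using clopK(1)[OF Q(1)] vK unfolding W_def K_def by blast
  \<comment> \<open>Openness off the top can be tested on the sets \<open>K n\<close>, because the
    open sets \<open>{z \<in> X - {v}. c n < \<rho> z}\<close> lie inside them and exhaust
    \<open>X - {v}\<close>.\<close>
  have op: "openin (top_of_set (X - {v})) Z"
    if Z: "Z \<subseteq> X - {v}" "\<And>n. openin (top_of_set (K n)) (Z \<inter> K n)" for Z
  proof -
    have "openin (top_of_set (X - {v})) (Z \<inter> {z \<in> X - {v}. c n < \<rho> z})" for n
    proof -
      obtain T where T: "open T" "Z \<inter> K n = K n \<inter> T" using Z(2)[of n] unfolding openin_open by blast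
      have "Z \<inter> {z \<in> X - {v}. c n < \<rho> z} = ((X - {v}) \<inter> \<rho> -` {c n<..}) \<inter> T"
        using T(2) Z(1) unfolding K_def by (auto simp: less_imp_le set_eq_iff)
      moreover have "openin (top_of_set (X - {v})) ((X - {v}) \<inter> \<rho> -` {c n<..})"
        by (rule continuous_openin_preimage_gen) (use cont in \<open>auto intro: continuous_on_subset\<close>)
      ultimately show ?thesis using T(1) openin_Int_open by metis
    qed
    moreover have "Z = (\<Union>n. Z \<inter> {z \<in> X - {v}. c n < \<rho> z})"
    proof -
      have "\<exists>n. c n < \<rho> z" if "z \<in> Z" for z
      proof -
        have "0 < \<rho> z" using that Z(1) pos by blast
        then have "0 < \<rho> z / \<delta>" using \<delta> by simp
        then obtain n where "(1/2) ^ n < \<rho> z / \<delta>" using real_arch_pow_inv[of "\<rho> z / \<delta>" "1/2"] by auto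
        then show ?thesis using \<delta> by (intro exI[of _ n]) (simp add: c_def field_simps power_one_over)
      qed
      then show ?thesis using Z(1) by blast
    qed
    ultimately show ?thesis by (metis (no_types, lifting) imageE openin_Union)
  qed
  have "openin (top_of_set (X - {v})) W"
    using op[OF W_sub] WK Q(1) unfolding clop_def by simp
  moreover have "closedin (top_of_set (X - {v})) W"
  proof -
    have "(X - {v} - W) \<inter> K n = K n - Q n" for n using WK[of n] vK[of n] unfolding K_def by blast
    then have "openin (top_of_set (X - {v})) (X - {v} - W)"
      using Q(1) unfolding clop_def by (intro op) (auto intro: openin_diff)
    then show ?thesis using W_sub by (simp add: closedin_def)
  qed
  moreover have "x \<in> W" "y \<notin> W" using Q(2,3) by (auto simp: W_def)
  ultimately show ?thesis by blast
qed

text \<open>For each pair of balls that some clopen set separates, one such set is chosen. Centres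
  in a dense sequence and radii \<open>1 / Suc m\<close> keep the family countable.\<close>

lemma separating_family:
  "\<exists>U :: nat \<Rightarrow> 'a set. (\<forall>n. openin (top_of_set (X - {v})) (U n)) \<and>
    (\<forall>n. closedin (top_of_set (X - {v})) (U n)) \<and>
    (\<forall>x\<in>X - {v}. \<forall>y\<in>X - {v}. (\<forall>n. x \<in> U n \<longleftrightarrow> y \<in> U n) \<longleftrightarrow> comparable x y)"
proof -
  obtain \<rho> :: "'a \<Rightarrow> real" where \<rho>: "continuous_on X \<rho>" "\<rho> v = 0"
    "\<forall>x\<in>X. \<forall>z\<in>X. seg z \<subseteq> seg x \<longrightarrow> \<rho> z \<le> \<rho> x"
    "\<forall>x\<in>X. \<forall>z\<in>X. seg z \<subset> seg x \<longrightarrow> \<rho> z < \<rho> x"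
    using radial_function[OF continuous_on_id] unfolding image_ident by blast
  have mono: "\<rho> z \<le> \<rho> x" if "x \<in> X" "z \<in> seg x" for x z
    using \<rho>(3) seg_trans[OF that] seg_subset[OF that(1)] that by blast
  have pos: "0 < \<rho> x" if "x \<in> X - {v}" for x
  proof -
    have "seg v \<subset> seg x" using that in_seg[of x] v_in_seg[of x] by (auto simp: seg_v)
    then show ?thesis using \<rho>(2,4) that v_in by (metis DiffD1)
  qed
  define clop where "clop W \<longleftrightarrow> openin (top_of_set (X - {v})) W \<and> closedin (top_of_set (X - {v})) W" for W
  obtain q :: "nat \<Rightarrow> 'a" where q: "\<And>n. q n \<in> X" "\<And>x e. x \<in> X \<Longrightarrow> 0 < e \<Longrightarrow> \<exists>n. dist (q n) x < e"
    using compact_dense_sequence[OF compact_X X_nonempty] by metis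
  define sep where "sep = (\<lambda>(i, j, m::nat) W. clop W \<and> (X - {v}) \<inter> ball (q i) (1 / Suc m) \<subseteq> W \<and>
     W \<inter> ball (q j) (1 / Suc m) = {})"
  \<comment> \<open>The default \<open>{}\<close> is clopen, so indices of balls that cannot be
    separated do no harm.\<close>
  define U where "U n = (let t = from_nat n in if \<exists>W. sep t W then SOME W. sep t W else {})" for n
  have U_sep: "sep t (U (to_nat t))" if "\<exists>W. sep t W" for t
    using someI_ex[OF that] that by (simp add: U_def)
  have U_clop: "clop (U n)" for n
  proof (cases "\<exists>W. sep (from_nat n) W")
    case True
    then have "sep (from_nat n) (U n)" using someI_ex[OF True] by (simp add: U_def)
    then show ?thesis by (simp add: sep_def case_prod_unfold)
  next
    case False
    then have "U n = {}" by (auto simp: U_def Let_def)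
    then show ?thesis by (simp add: clop_def)
  qed
  have iff: "(\<forall>n. x \<in> U n \<longleftrightarrow> y \<in> U n) \<longleftrightarrow> comparable x y" if xy: "x \<in> X - {v}" "y \<in> X - {v}" for x y
  proof
    assume comp: "comparable x y"
    have "\<exists>I. connected I \<and> x \<in> I \<and> y \<in> I \<and> I \<subseteq> {u \<in> X. min (\<rho> x) (\<rho> y) \<le> \<rho> u}"
      by (rule comparable_connected[OF mono _ _ comp]) (use xy in auto)
    then obtain I where I: "connected I" "x \<in> I" "y \<in> I" "I \<subseteq> {u \<in> X. min (\<rho> x) (\<rho> y) \<le> \<rho> u}"
      by auto
    have Iv: "I \<subseteq> X - {v}" using I(4) pos[OF xy(1)] pos[OF xy(2)] \<rho>(2) by force
    show "\<forall>n. x \<in> U n \<longleftrightarrow> y \<in> U n"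
    proof
      fix n
      have "connectedin (top_of_set (X - {v})) I" using I(1) Iv by (simp add: connectedin_subtopology)
      then have "I \<subseteq> U n \<or> disjnt I (U n)"
        using U_clop[of n] unfolding clop_def by (intro connectedin_clopen_cases) auto
      then show "x \<in> U n \<longleftrightarrow> y \<in> U n" using I(2,3) by (auto simp: disjnt_def)
    qed
  next
    assume same: "\<forall>n. x \<in> U n \<longleftrightarrow> y \<in> U n"
    show "comparable x y"
    proof (rule ccontr)
      assume inc: "\<not> comparable x y"
      obtain W where W: "clop W" "x \<in> W" "y \<notin> W"
        using leg_clopen_separation[OF \<rho>(1,2) pos mono xy inc] unfolding clop_def by blast
      obtain e1 where e1: "e1 > 0" "\<And>z. z \<in> X - {v} \<Longrightarrow> dist z x < e1 \<Longrightarrow> z \<in> W"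
        using W unfolding clop_def openin_euclidean_subtopology_iff by metis
      have "openin (top_of_set (X - {v})) (X - {v} - W)"
        using W(1) unfolding clop_def by (metis openin_diff openin_topspace topspace_euclidean_subtopology)
      then obtain e2 where e2: "e2 > 0" "\<And>z. z \<in> X - {v} \<Longrightarrow> dist z y < e2 \<Longrightarrow> z \<in> X - {v} - W"
        using W(3) xy(2) unfolding openin_euclidean_subtopology_iff by (metis DiffI)
      \<comment> \<open>With a radius below half of \<open>min e1 e2\<close>, a ball whose centre is
        within that radius of \<open>x\<close> or \<open>y\<close> stays inside the neighbourhood
        found there.\<close>
      obtain m where m: "inverse (real (Suc m)) < min e1 e2 / 2"
        using reals_Archimedean[of "min e1 e2 / 2"] e1 e2 by auto
      let ?r = "1 / real (Suc m)"
      obtain i where i: "dist (q i) x < ?r" using q(2)[of x ?r] xy by auto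
      obtain j where j: "dist (q j) y < ?r" using q(2)[of y ?r] xy by auto
      have r2: "2 * ?r < min e1 e2" using m by (simp add: inverse_eq_divide)
      have "(X - {v}) \<inter> ball (q i) ?r \<subseteq> W"
      proof
        fix z assume z: "z \<in> (X - {v}) \<inter> ball (q i) ?r"
        then have "dist (q i) z < ?r" by simp
        then have "dist z x < e1" using i r2 dist_triangle[of z x "q i"] by (simp add: dist_commute)
        then show "z \<in> W" using e1(2) z by blast
      qed
      moreover have "W \<inter> ball (q j) ?r = {}"
      proof (rule ccontr)
        assume "W \<inter> ball (q j) ?r \<noteq> {}"
        then obtain z where z: "z \<in> W" "dist (q j) z < ?r" by auto
        then have "dist z y < e2" using j r2 dist_triangle[of z y "q j"] by (simp add: dist_commute)
        moreover have "z \<in> X - {v}" using z W(1) openin_imp_subset unfolding clop_def by blast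
        ultimately show False using e2(2) z by blast
      qed
      ultimately have "sep (i, j, m) W" using W(1) by (simp add: sep_def)
      then have S: "sep (i, j, m) (U (to_nat (i, j, m)))" using U_sep by blast
      have "x \<in> U (to_nat (i, j, m))" using S i xy unfolding sep_def by auto
      moreover have "y \<notin> U (to_nat (i, j, m))" using S j unfolding sep_def by auto
      ultimately show False using same by blast
    qed
  qed
  show ?thesis using U_clop iff unfolding clop_def by (intro exI[of _ U]) blast
qed

end

section \<open>Monotone images\<close>

text \<open>Fibres are continua: off \<open>w\<close> each lies on one leg, and order-convexity
  makes \<open>f\<close> monotone along legs. So legs not collapsed to \<open>w\<close> are carried
  to legs of \<open>Y\<close>, with height measured by image arcs. The identity as \<open>f\<close>
  yields the structure of the fan itself.\<close>

theorem (in smooth_fan_top) monotone_image_leg_structure: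
  fixes f :: "'a \<Rightarrow> 'b::metric_space"
  assumes dense_ends: "closure (end_points X) = X" and mono_f: "monotone_map X f"
    and Y: "f ` X = Y" "nondegenerate Y"
  shows "\<exists>w \<sigma> V. leg_structure Y w \<sigma> V"
proof -
  define w where "w = f v"
  have f: "continuous_on X f" using mono_f unfolding monotone_map_def by blast
  have fiber: "continuum {z \<in> X. f z = f x}" if "x \<in> X" for x
  proof -
    have "{z \<in> X. f z = f x} = X \<inter> f -` {f x}" by auto
    moreover have "closed (X \<inter> f -` {f x})"
      by (rule continuous_closed_preimage[OF f compact_imp_closed[OF compact_X] closed_singleton])
    ultimately have "compact {z \<in> X. f z = f x}"
      using compact_X by (metis Int_lower1 closed_Int_compact inf.absorb_iff1)
    moreover have "connected {z \<in> X. f z = f x}"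
      using mono_f that unfolding monotone_map_def by blast
    ultimately show ?thesis unfolding continuum_def using that by blast
  qed
  have convex: "f u = f x" if "x \<in> X" "z \<in> X" "f z = f x" "x \<in> seg u" "u \<in> seg z" for x z u
    using continuum_order_convex[OF _ fiber[OF that(1)], of x z u] that by blast
  have fiber_leg: "comparable x z" if "x \<in> X" "z \<in> X" "f z = f x" "f x \<noteq> w" for x z
    using continuum_one_leg[OF _ fiber[OF that(1)], of x z] that unfolding comparable_def w_def by auto
  \<comment> \<open>The points of \<open>seg z\<close> outside \<open>seg x\<close> lie between
    \<open>x\<close> and \<open>z\<close>, hence in the same fibre.\<close>
  have upward: "f ` seg z = f ` seg x" if "x \<in> X" "z \<in> X" "f z = f x" "x \<in> seg z" for x z
  proof
    show "f ` seg x \<subseteq> f ` seg z" using seg_trans that by blast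
    show "f ` seg z \<subseteq> f ` seg x"
    proof
      fix y assume "y \<in> f ` seg z"
      then obtain u where u: "u \<in> seg z" "y = f u" by blast
      show "y \<in> f ` seg x"
      proof (cases "u \<in> seg x")
        case True then show ?thesis using u by blast
      next
        case False
        then have "x \<in> seg u" using seg_linear[OF that(2) that(4) u(1)] by blast
        then have "y = f x" using convex[OF that(1-3) _ u(1)] u(2) by simp
        then show ?thesis using in_seg[OF that(1)] by blast
      qed
    qed
  qed
  \<comment> \<open>Points of the fibre over \<open>w\<close> may be incomparable, but there every
    image arc is \<open>{w}\<close>, since the fibre contains \<open>v\<close>.\<close>
  have image_seg: "f ` seg z = f ` seg x" if "x \<in> X" "z \<in> X" "f z = f x" for x z
  proof (cases "f x = w")
    case True
    have "f ` seg u = {w}" if "u \<in> X" "f u = w" for u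
      using upward[OF v_in that(1) _ v_in_seg[OF that(1)]] that(2) by (simp add: w_def seg_v)
    then show ?thesis using True that by metis
  next
    case False
    then have "comparable x z" using fiber_leg that by blast
    then show ?thesis using upward[of x z] upward[of z x] that unfolding comparable_def by metis
  qed
  obtain h :: "'a \<Rightarrow> real" where h: "continuous_on X h" "h v = 0"
    "\<forall>x\<in>X. \<forall>z\<in>X. f ` seg z \<subseteq> f ` seg x \<longrightarrow> h z \<le> h x"
    "\<forall>x\<in>X. \<forall>z\<in>X. f ` seg z \<subset> f ` seg x \<longrightarrow> h z < h x"
    using radial_function[OF f] by blast
  have h_fiber: "h z = h x" if "x \<in> X" "z \<in> X" "f z = f x" for x z
    using h(3) image_seg[OF that] that by (metis order_antisym order_refl)
  have h_mono: "h z \<le> h x" if "x \<in> X" "z \<in> seg x" for x z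
    using h(3) seg_trans[OF that] seg_subset[OF that(1)] that by blast
  have h_strict: "h z < h x" if "x \<in> X" "z \<in> seg x" "f z \<noteq> f x" for x z
  proof -
    have z: "z \<in> X" using seg_subset that by blast
    \<comment> \<open>Otherwise \<open>z\<close> lies between two points of the fibre of
      \<open>x\<close> and belongs to it.\<close>
    have "f x \<notin> f ` seg z"
    proof
      assume "f x \<in> f ` seg z"
      then obtain u where u: "u \<in> seg z" "f x = f u" by blast
      have "u \<in> X" using u seg_subset[OF z] by blast
      then have "f z = f u" using convex[of u x z] u that by blast
      then show False using u that by simp
    qed
    then have "f ` seg z \<subset> f ` seg x" using seg_trans[OF that(1,2)] in_seg[OF that(1)] by blast
    then show ?thesis using h(4) that z by blast
  qed
  have h_pos: "0 < h x" if "x \<in> X" "f x \<noteq> w" for x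
    using h_strict[OF that(1) v_in_seg[OF that(1)]] that(2) h(2) by (simp add: w_def)
  \<comment> \<open>\<open>h\<close> is constant on fibres by \<open>h_fiber\<close>, so the choice
    of preimage is immaterial.\<close>
  define \<sigma> where "\<sigma> y = h (SOME x. x \<in> X \<and> f x = y)" for y
  have \<sigma>f: "\<sigma> (f x) = h x" if "x \<in> X" for x
  proof -
    have "(SOME u. u \<in> X \<and> f u = f x) \<in> X \<and> f (SOME u. u \<in> X \<and> f u = f x) = f x"
      using that by (intro someI_ex[of "\<lambda>u. u \<in> X \<and> f u = f x"]) blast
    then show ?thesis unfolding \<sigma>_def using h_fiber[OF that] by blast
  qed
  obtain U :: "nat \<Rightarrow> 'a set" where U: "\<And>n. openin (top_of_set (X - {v})) (U n)"
      "\<And>n. closedin (top_of_set (X - {v})) (U n)"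
      and Uc: "\<forall>x\<in>X - {v}. \<forall>y\<in>X - {v}. (\<forall>n. x \<in> U n \<longleftrightarrow> y \<in> U n) \<longleftrightarrow> comparable x y"
    using separating_family by blast
  \<comment> \<open>\<open>w\<close> is taken out because a leg contained in \<open>U n\<close> may
    begin inside the fibre over \<open>w\<close>.\<close>
  define V where "V n = (Y - {w}) \<inter> f ` U n" for n
  have nv: "x \<in> X - {v}" if "x \<in> X" "f x \<noteq> w" for x using that by (auto simp: w_def)
  have U_sub: "U n \<subseteq> X - {v}" for n using U(1) openin_imp_subset by blast
  have V_iff: "f x \<in> V n \<longleftrightarrow> x \<in> U n" if x: "x \<in> X" "f x \<noteq> w" for x n
  proof
    assume "f x \<in> V n"
    then obtain u where u: "u \<in> U n" "f x = f u" unfolding V_def by blast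
    then have uX: "u \<in> X - {v}" using U_sub by blast
    have "comparable x u" using fiber_leg[of x u] x u uX by simp
    then show "x \<in> U n" using Uc nv[OF x] uX u(1) by blast
  next
    assume "x \<in> U n"
    then show "f x \<in> V n" using x Y(1) unfolding V_def by blast
  qed
  have same: "(\<forall>n. f x \<in> V n \<longleftrightarrow> f z \<in> V n) \<longleftrightarrow> comparable x z"
    if "x \<in> X" "f x \<noteq> w" "z \<in> X" "f z \<noteq> w" for x z
    using Uc nv[OF that(1,2)] nv[OF that(3,4)] V_iff[OF that(1,2)] V_iff[OF that(3,4)] by simp
  \<comment> \<open>A relatively closed set becomes compact when \<open>v\<close> is added, and this
    changes its image at most by \<open>w\<close>.\<close>
  have image_closed: "closedin (top_of_set (Y - {w})) ((Y - {w}) \<inter> f ` Z)"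
    if Z: "closedin (top_of_set (X - {v})) Z" for Z
  proof -
    obtain C where C: "closed C" "Z = (X - {v}) \<inter> C" using Z unfolding closedin_closed by blast
    have "compact (f ` (X \<inter> C))"
      using f C(1) compact_X by (meson Int_lower1 compact_Int_closed compact_continuous_image continuous_on_subset)
    moreover have "(Y - {w}) \<inter> f ` Z = (Y - {w}) \<inter> f ` (X \<inter> C)"
      using C(2) by (auto simp: w_def)
    ultimately show ?thesis unfolding closedin_closed using compact_imp_closed by blast
  qed
  have "leg_structure Y w \<sigma> V"
  proof
    show "compact Y" using compact_continuous_image[OF f compact_X] Y(1) by simp
    show "w \<in> Y" using v_in Y(1) by (auto simp: w_def)
    show "continuous_on Y \<sigma>"
      unfolding continuous_on_closed_invariant
    proof (intro allI impI)
      fix B :: "real set" assume "closed B"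
      then have "closed (X \<inter> h -` B)"
        using continuous_closed_preimage[OF h(1) compact_imp_closed[OF compact_X]] by blast
      then have "compact (X \<inter> (X \<inter> h -` B))" by (rule compact_Int_closed[OF compact_X])
      then have "compact (f ` (X \<inter> h -` B))"
        using f by (intro compact_continuous_image) (auto intro: continuous_on_subset)
      moreover have "f ` (X \<inter> h -` B) \<inter> Y = \<sigma> -` B \<inter> Y"
        using \<sigma>f Y(1) by force
      ultimately show "\<exists>A. closed A \<and> A \<inter> Y = \<sigma> -` B \<inter> Y" using compact_imp_closed by blast
    qed
    show "\<sigma> w = 0" using \<sigma>f[OF v_in] h(2) by (simp add: w_def)
    show "0 < \<sigma> y" if y: "y \<in> Y - {w}" for y
    proof -
      obtain x where "x \<in> X" "y = f x" using y Y(1) by blast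
      then show ?thesis using \<sigma>f h_pos y by simp
    qed
    show "closedin (top_of_set (Y - {w})) (V n)" for n
      unfolding V_def by (rule image_closed[OF U(2)])
    show "openin (top_of_set (Y - {w})) (V n)" for n
    proof -
      \<comment> \<open>Off \<open>w\<close> the set \<open>U n\<close> is a union of fibres, so the
        complement of \<open>V n\<close> comes from the complement of \<open>U n\<close>, whose
        image is relatively closed.\<close>
      have "closedin (top_of_set (X - {v})) (X - {v} - U n)"
        using U(1)[of n] by (metis closedin_diff closedin_topspace topspace_euclidean_subtopology)
      then have "closedin (top_of_set (Y - {w})) ((Y - {w}) \<inter> f ` (X - {v} - U n))"
        by (rule image_closed)
      moreover have "(Y - {w}) \<inter> f ` (X - {v} - U n) = (Y - {w}) - V n"
      proof -
        have "f x \<in> (Y - {w}) \<inter> f ` (X - {v} - U n) \<longleftrightarrow> f x \<in> (Y - {w}) - V n" if "x \<in> X" for x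
        proof (cases "f x = w")
          case False
          have "f x \<in> f ` (X - {v} - U n) \<longleftrightarrow> x \<notin> U n"
          proof
            assume "f x \<in> f ` (X - {v} - U n)"
            then obtain u where u: "u \<in> X" "u \<notin> U n" "f x = f u" by blast
            then show "x \<notin> U n" using V_iff[of u n] V_iff[OF that False, of n] False by simp
          next
            assume "x \<notin> U n"
            then show "f x \<in> f ` (X - {v} - U n)" using nv[OF that False] by blast
          qed
          then show ?thesis using V_iff[OF that False] False that Y(1) by blast
        qed simp
        then show ?thesis using Y(1) by blast
      qed
      ultimately show ?thesis using openin_closedin_eq[of "top_of_set (Y - {w})" "V n"]
        by (auto simp: V_def)
    qed
    show "y = y'" if y: "y \<in> Y - {w}" "y' \<in> Y - {w}" "\<forall>n. y \<in> V n \<longleftrightarrow> y' \<in> V n" "\<sigma> y = \<sigma> y'" for y y'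
    proof -
      obtain x x' where x: "x \<in> X" "y = f x" "x' \<in> X" "y' = f x'" using y(1,2) Y(1) by blast
      then have "comparable x x'" using same[of x x'] y by simp
      then show ?thesis using h_strict[of x' x] h_strict[of x x'] x y(4) \<sigma>f unfolding comparable_def by force
    qed
    show "\<exists>y'\<in>Y - {w}. (\<forall>n. y' \<in> V n \<longleftrightarrow> y \<in> V n) \<and> \<sigma> y' = t" if y: "y \<in> Y - {w}" "0 < t" "t \<le> \<sigma> y" for y t
    proof -
      obtain x where x: "x \<in> X" "y = f x" using y(1) Y(1) by blast
      have "connected (h ` seg x)"
        using h(1) seg_connected[OF x(1)] seg_subset[OF x(1)] by (meson connected_continuous_image continuous_on_subset)
      moreover have "0 \<in> h ` seg x" "h x \<in> h ` seg x"
        using h(2) v_in_seg[OF x(1)] in_seg[OF x(1)] by force+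
      ultimately have "{0..h x} \<subseteq> h ` seg x" using connected_contains_Icc by blast
      moreover have "t \<in> {0..h x}" using y x \<sigma>f by auto
      ultimately obtain u where u: "u \<in> seg x" "h u = t" by blast
      have uX: "u \<in> X" using u seg_subset[OF x(1)] by blast
      have "f u \<noteq> w" using \<sigma>f[OF uX] \<sigma>f[OF v_in] h(2) u(2) y(2) by (auto simp: w_def)
      moreover from this have "\<forall>n. f u \<in> V n \<longleftrightarrow> y \<in> V n"
        using same[of u x] uX x y(1) u(1) unfolding comparable_def by simp
      ultimately show ?thesis using uX Y(1) \<sigma>f[OF uX] u(2) by (intro bexI[of _ "f u"]) auto
    qed
    show "\<exists>e\<in>Y - {w}. dist e y < \<epsilon> \<and> (\<forall>y'\<in>Y - {w}. (\<forall>n. y' \<in> V n \<longleftrightarrow> e \<in> V n) \<longrightarrow> \<sigma> y' \<le> \<sigma> e)"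
      if y: "y \<in> Y - {w}" "0 < \<epsilon>" for y \<epsilon>
    proof -
      obtain x where x: "x \<in> X" "y = f x" using y(1) Y(1) by blast
      \<comment> \<open>The bound \<open>dist w y\<close> keeps the image of the nearby end point
        away from \<open>w\<close>, so that its leg survives in \<open>Y\<close>.\<close>
      have "0 < min \<epsilon> (dist w y)" using y by auto
      then obtain \<delta> where \<delta>: "\<delta> > 0" "\<And>u. u \<in> X \<Longrightarrow> dist u x < \<delta> \<Longrightarrow> dist (f u) (f x) < min \<epsilon> (dist w y)"
        using f x(1) unfolding continuous_on_iff by metis
      have "x \<in> closure (end_points X)" using dense_ends x by simp
      then obtain e where e: "e \<in> end_points X" "dist e x < \<delta>"
        using \<delta>(1) unfolding closure_approachable by blast
      have eX: "e \<in> X" using e(1) unfolding end_points_def by blast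
      have fe: "dist (f e) y < \<epsilon>" "dist (f e) y < dist w y" using \<delta>(2)[OF eX e(2)] x by auto
      then have few: "f e \<noteq> w" by auto
      have "\<sigma> y' \<le> \<sigma> (f e)" if y': "y' \<in> Y - {w}" "\<forall>n. y' \<in> V n \<longleftrightarrow> f e \<in> V n" for y'
      proof -
        obtain z where z: "z \<in> X" "y' = f z" using y'(1) Y(1) by blast
        then have "comparable z e" using same[of z e] y' eX few by simp
        moreover have "e \<noteq> v" using few by (auto simp: w_def)
        ultimately have "z \<in> seg e" using end_point_maximal[OF e(1) z(1)] in_seg[OF eX] unfolding comparable_def by blast
        then show ?thesis using h_mono[OF eX] \<sigma>f z eX by simp
      qed
      then show ?thesis using few fe Y(1) eX by (intro bexI[of _ "f e"]) auto
    qed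
    show "Y - {w} \<noteq> {}" using Y(2) unfolding nondegenerate_def by blast
  qed
  then show ?thesis by blast
qed

section \<open>Topological invariance\<close>

lemma arc_in_image:
  assumes h: "homeomorphism X Z h k" and A: "arc_in X a b A"
  shows "arc_in Z (h a) (h b) (h ` A)"
proof -
  obtain g where g: "arc g" "pathstart g = a" "pathfinish g = b" "path_image g = A" "A \<subseteq> X"
    using A unfolding arc_in_def by blast
  have cont: "continuous_on A h" using h g(5) by (meson continuous_on_subset homeomorphism_cont1)
  have inj: "inj_on h A" using h g(5) by (metis homeomorphism_apply1 inj_on_def subsetD)
  have "path (h \<circ> g)"
    using g(1,4) cont unfolding arc_def path_def path_image_def by (metis continuous_on_compose)
  moreover have "inj_on (h \<circ> g) {0..1}"
    using g(1,4) inj unfolding arc_def path_image_def by (metis comp_inj_on)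
  moreover have "path_image (h \<circ> g) = h ` A" using g(4) by (simp add: path_image_compose)
  moreover have "pathstart (h \<circ> g) = h a" "pathfinish (h \<circ> g) = h b"
    using g(2,3) by (simp_all add: pathstart_compose pathfinish_compose)
  moreover have "h ` A \<subseteq> Z" using h g(5) by (metis homeomorphism_image1 image_mono)
  ultimately show ?thesis unfolding arc_in_def arc_def by blast
qed

lemma ramification_point_image:
  assumes h: "homeomorphism X Z h k" and u: "ramification_point X u"
  shows "ramification_point Z (h u)"
proof -
  obtain a b c A B C where *: "arc_in X u a A" "arc_in X u b B" "arc_in X u c C"
      "A \<inter> B = {u}" "A \<inter> C = {u}" "B \<inter> C = {u}" "u \<in> X"
    using u unfolding ramification_point_def by blast
  have "A \<subseteq> X" "B \<subseteq> X" "C \<subseteq> X" using *(1-3) unfolding arc_in_def by auto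
  moreover have inj: "inj_on h X" using h by (metis homeomorphism_apply1 inj_on_def)
  ultimately have "h ` A \<inter> h ` B = {h u}" "h ` A \<inter> h ` C = {h u}" "h ` B \<inter> h ` C = {h u}"
    using *(4-6) by (metis inj_on_image_Int image_empty image_insert)+
  moreover have "h u \<in> Z" using h *(7) by (metis homeomorphism_image1 imageI)
  ultimately show ?thesis unfolding ramification_point_def
    using arc_in_image[OF h *(1)] arc_in_image[OF h *(2)] arc_in_image[OF h *(3)] by blast
qed

lemma end_points_image:
  assumes h: "homeomorphism X Z h k"
  shows "h ` end_points X \<subseteq> end_points Z"
proof
  fix y assume "y \<in> h ` end_points X"
  then obtain x where x: "x \<in> X" "\<And>a b A. arc_in X a b A \<Longrightarrow> x \<in> A \<Longrightarrow> x = a \<or> x = b" and y: "y = h x"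
    unfolding end_points_def by blast
  have "y = a \<or> y = b" if "arc_in Z a b A" "y \<in> A" for a b A
  proof -
    have "x \<in> k ` A" using that(2) y x h by (metis homeomorphism_apply1 imageI)
    then have "x = k a \<or> x = k b"
      using x(2) arc_in_image[OF homeomorphism_symD[OF h] that(1)] by blast
    moreover have "a \<in> Z" "b \<in> Z" using that(1) unfolding arc_in_def by auto
    ultimately show ?thesis using y h by (metis homeomorphism_apply2)
  qed
  moreover have "y \<in> Z" using x y h by (metis homeomorphism_image1 imageI)
  ultimately show "y \<in> end_points Z" unfolding end_points_def by blast
qed

lemma continuum_image:
  assumes "continuum A" "continuous_on A h"
  shows "continuum (h ` A)"
  using assms unfolding continuum_def by (simp add: compact_continuous_image connected_continuous_image)

lemma fan_homeomorphic:
  assumes h: "homeomorphism X Z h k" and fan: "fan X"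
  shows "fan Z"
proof -
  have k: "homeomorphism Z X k h" using h by (rule homeomorphism_symD)
  have hX: "h ` X = Z" and kZ: "k ` Z = X" and ch: "continuous_on X h" and ck: "continuous_on Z k"
    and hk: "\<And>z. z \<in> Z \<Longrightarrow> h (k z) = z"
    using h unfolding homeomorphism_def by auto
  have X: "continuum X" "arcwise_connected X" "hereditarily_unicoherent X"
      "\<And>u v. ramification_point X u \<Longrightarrow> ramification_point X v \<Longrightarrow> u = v"
    using fan unfolding fan_def dendroid_def by blast+
  have "continuum Z" using continuum_image[OF X(1) ch] hX by simp
  moreover have "arcwise_connected Z"
    unfolding arcwise_connected_def
  proof (intro ballI impI)
    fix x y assume xy: "x \<in> Z" "y \<in> Z" "x \<noteq> y"
    then have "k x \<in> X" "k y \<in> X" "k x \<noteq> k y" using kZ hk by (blast, blast, metis)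
    then obtain A where "arc_in X (k x) (k y) A" using X(2) unfolding arcwise_connected_def by blast
    then show "\<exists>A. arc_in Z x y A" using arc_in_image[OF h] hk xy by metis
  qed
  moreover have "hereditarily_unicoherent Z"
    unfolding hereditarily_unicoherent_def
  proof (intro allI impI)
    fix A B assume AB: "A \<subseteq> Z \<and> B \<subseteq> Z \<and> continuum A \<and> continuum B"
    then have "continuum (k ` A)" "continuum (k ` B)" "k ` A \<subseteq> X" "k ` B \<subseteq> X"
      using continuum_image ck kZ by (meson continuous_on_subset, meson continuous_on_subset, blast, blast)
    then have "connected (k ` A \<inter> k ` B)" using X(3) unfolding hereditarily_unicoherent_def by blast
    then have "connected (h ` (k ` A \<inter> k ` B))"
      using ch \<open>k ` A \<subseteq> X\<close> by (meson connected_continuous_image continuous_on_subset inf.coboundedI1)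
    moreover have "h ` (k ` A \<inter> k ` B) = A \<inter> B"
    proof -
      have "inj_on k Z" using hk by (metis inj_on_inverseI)
      then have "k ` A \<inter> k ` B = k ` (A \<inter> B)" using AB by (metis inj_on_image_Int)
      moreover have "h ` k ` (A \<inter> B) = A \<inter> B" using hk AB by force
      ultimately show ?thesis by simp
    qed
    ultimately show "connected (A \<inter> B)" by simp
  qed
  moreover have "u = v" if uv: "ramification_point Z u" "ramification_point Z v" for u v
  proof -
    have "k u = k v" using X(4) ramification_point_image[OF k] uv by blast
    moreover have "u \<in> Z" "v \<in> Z" using uv unfolding ramification_point_def by auto
    ultimately show ?thesis using hk by metis
  qed
  ultimately show ?thesis unfolding fan_def dendroid_def by blast
qed

text \<open>A homeomorphism carries arcs from \<open>v\<close> to arcs from \<open>h v\<close>;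
  being uniformly continuous on the compact \<open>X\<close>, it preserves their Hausdorff
  convergence.\<close>

lemma smooth_fan_with_top_homeomorphic:
  assumes h: "homeomorphism X Z h k" and smooth: "smooth_fan_with_top X v"
  shows "smooth_fan_with_top Z (h v)"
proof -
  interpret smooth_fan_top X v by (standard, rule smooth)
  have k: "homeomorphism Z X k h" using h by (rule homeomorphism_symD)
  have hX: "h ` X = Z" and kZ: "k ` Z = X" and ch: "continuous_on X h" and ck: "continuous_on Z k"
    and hk: "\<And>z. z \<in> Z \<Longrightarrow> h (k z) = z" and kh: "\<And>x. x \<in> X \<Longrightarrow> k (h x) = x"
    using h unfolding homeomorphism_def by auto
  have seg_image: "arc_from Z (h v) z = h ` seg (k z)" if z: "z \<in> Z" for z
  proof (cases "z = h v")
    case True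
    then show ?thesis using kh[OF v_in] by (simp add: arc_from_def)
  next
    case False
    have kz: "k z \<in> X" "k z \<noteq> v" using z kZ hk[OF z] False by auto
    then obtain A where A: "arc_in X v (k z) A" using arcwise[OF v_in kz(1)] by blast
    have "arc_in Z (h v) z (h ` A)" using arc_in_image[OF h A] hk[OF z] by simp
    moreover have "B = h ` A" if B: "arc_in Z (h v) z B" for B
    proof -
      have "arc_in X v (k z) (k ` B)" using arc_in_image[OF k B] kh[OF v_in] by simp
      then have "k ` B = A" using arc_in_unique A by blast
      moreover have "B \<subseteq> Z" using B unfolding arc_in_def by auto
      then have "h ` k ` B = B" using hk by force
      ultimately show ?thesis by simp
    qed
    ultimately have "(THE B. arc_in Z (h v) z B) = h ` A" by (rule the_equality)
    then show ?thesis using False seg_eq[OF A] by (simp add: arc_from_def)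
  qed
  have "(\<lambda>n. hausdorff_dist (arc_from Z (h v) (s n)) (arc_from Z (h v) z)) \<longlonglongrightarrow> 0"
    if z: "z \<in> Z" and s: "\<And>n. s n \<in> Z" "s \<longlonglongrightarrow> z" for z s
  proof -
    have kz: "k z \<in> X" "\<And>n. k (s n) \<in> X" using z s(1) kZ by auto
    have "(\<lambda>n. k (s n)) \<longlonglongrightarrow> k z"
      using continuous_on_tendsto_compose[OF ck s(2) z] s(1) by simp
    then have lim: "(\<lambda>n. hausdorff_dist (seg (k (s n))) (seg (k z))) \<longlonglongrightarrow> 0"
      by (rule smooth_limit[OF kz])
    have comp: "compact (seg x)" "seg x \<noteq> {}" "seg x \<subseteq> X" if "x \<in> X" for x
      using seg_compact[OF that] v_in_seg[OF that] seg_subset[OF that] by auto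
    have comp_h: "compact (h ` seg x)" "h ` seg x \<noteq> {}" if "x \<in> X" for x
      using comp[OF that] ch by (auto intro: compact_continuous_image continuous_on_subset)
    show ?thesis
      unfolding lim_sequentially
    proof (intro allI impI)
      fix \<epsilon> :: real assume "\<epsilon> > 0"
      then have e2: "\<epsilon> / 2 > 0" by simp
      obtain \<delta> where \<delta>: "\<delta> > 0" "\<And>a b. \<lbrakk>a \<in> X; b \<in> X; dist b a < \<delta>\<rbrakk> \<Longrightarrow> dist (h b) (h a) < \<epsilon> / 2"
        using compact_uniformly_continuous[OF ch compact_X] e2 unfolding uniformly_continuous_on_def by metis
      obtain N where N: "\<And>n. n \<ge> N \<Longrightarrow> hausdorff_dist (seg (k (s n))) (seg (k z)) < \<delta>"
        using order_tendstoD(2)[OF lim \<delta>(1)] unfolding eventually_sequentially by blast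
      have "dist (hausdorff_dist (arc_from Z (h v) (s n)) (arc_from Z (h v) z)) 0 < \<epsilon>" if "n \<ge> N" for n
      proof -
        let ?A = "seg (k (s n))" and ?B = "seg (k z)"
        note A = comp[OF kz(2)[of n]] and B = comp[OF kz(1)]
        note H = hausdorff_dist_lessD[OF A(1) B(1) A(2) B(2) N[OF that]]
        have "hausdorff_dist (h ` ?A) (h ` ?B) \<le> \<epsilon> / 2"
        proof (rule hausdorff_dist_leI)
          show "h ` ?A \<noteq> {}" "h ` ?B \<noteq> {}" using A(2) B(2) by auto
          fix y assume "y \<in> h ` ?A"
          then obtain a where a: "a \<in> ?A" "y = h a" by blast
          then obtain b where b: "b \<in> ?B" "dist a b < \<delta>" using H(1) by blast
          have "dist (h a) (h b) < \<epsilon> / 2" by (rule \<delta>(2)) (use a b A B in auto)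
          then show "\<exists>b\<in>h ` ?B. dist y b \<le> \<epsilon> / 2" using a b by (intro bexI[of _ "h b"]) auto
        next
          fix y assume "y \<in> h ` ?B"
          then obtain a where a: "a \<in> ?B" "y = h a" by blast
          then obtain b where b: "b \<in> ?A" "dist a b < \<delta>" using H(2) by blast
          have "dist (h a) (h b) < \<epsilon> / 2" by (rule \<delta>(2)) (use a b A B in auto)
          then show "\<exists>b\<in>h ` ?A. dist y b \<le> \<epsilon> / 2" using a b by (intro bexI[of _ "h b"]) auto
        qed
        moreover have "0 \<le> hausdorff_dist (h ` ?A) (h ` ?B)"
          by (rule hausdorff_dist_nonneg[OF comp_h[OF kz(2)]])
        ultimately show ?thesis
          using \<open>\<epsilon> > 0\<close> seg_image[OF z] seg_image[OF s(1)] by (simp add: dist_real_def)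
      qed
      then show "\<exists>N. \<forall>n\<ge>N. dist (hausdorff_dist (arc_from Z (h v) (s n)) (arc_from Z (h v) z)) 0 < \<epsilon>" by blast
    qed
  qed
  then show ?thesis
    unfolding smooth_fan_with_top_def
    using fan_homeomorphic[OF h fan_X] ramification_point_image[OF h ramification_v] by blast
qed

lemma Lelek_fan_homeomorphic:
  assumes h: "homeomorphism X Z h k" and L: "Lelek_fan X"
  shows "Lelek_fan Z"
proof -
  obtain v where v: "smooth_fan_with_top X v" using L unfolding Lelek_fan_def smooth_fan_def by blast
  then have v': "smooth_fan_with_top Z (h v)" by (rule smooth_fan_with_top_homeomorphic[OF h])
  then interpret Z: smooth_fan_top Z "h v" by (rule smooth_fan_top.intro)
  have cl: "closure (end_points X) = X" using L unfolding Lelek_fan_def by blast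
  have "h ` closure (end_points X) \<subseteq> closure (end_points Z)"
  proof (rule image_closure_subset)
    show "continuous_on (closure (end_points X)) h" using cl h by (simp add: homeomorphism_cont1)
    show "h ` end_points X \<subseteq> closure (end_points Z)"
      using end_points_image[OF h] closure_subset by blast
  qed simp
  then have "Z \<subseteq> closure (end_points Z)" using cl h by (simp add: homeomorphism_image1)
  moreover have "closure (end_points Z) \<subseteq> Z"
    by (rule closure_minimal) (auto simp: end_points_def Z.compact_X compact_imp_closed)
  ultimately show ?thesis using v' unfolding Lelek_fan_def smooth_fan_def by blast
qed

section \<open>Uniqueness of the Lelek fan and the three equivalent conditions\<close>

lemma monotone_image_Lelek_fan_leg_structure:
  assumes "Lelek_fan L" "monotone_map L f" "f ` L = Y" "nondegenerate Y"
  shows "\<exists>w \<sigma> V. leg_structure Y w \<sigma> V"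
proof -
  obtain v where "smooth_fan_with_top L v" using assms(1) unfolding Lelek_fan_def smooth_fan_def by blast
  then interpret smooth_fan_top L v by (rule smooth_fan_top.intro)
  show ?thesis
    using monotone_image_leg_structure[OF _ assms(2,3,4)] assms(1) unfolding Lelek_fan_def by blast
qed

lemma monotone_map_id: "monotone_map X (\<lambda>x. x)"
proof -
  have "{x \<in> X. x = z} = {z}" if "z \<in> X" for z using that by blast
  then show ?thesis unfolding monotone_map_def by (simp add: continuous_on_id)
qed

lemma Lelek_fan_nondegenerate:
  assumes "Lelek_fan X"
  shows "nondegenerate X"
proof -
  obtain v where "ramification_point X v"
    using assms unfolding Lelek_fan_def smooth_fan_def smooth_fan_with_top_def by blast
  then obtain g a where g: "arc g" "pathstart g = v" "pathfinish g = a" "path_image g \<subseteq> X"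
    unfolding ramification_point_def arc_in_def by metis
  then have "v \<noteq> a" "v \<in> X" "a \<in> X" using arc_distinct_ends[OF g(1)] by auto
  then show ?thesis unfolding nondegenerate_def by blast
qed

text \<open>Two fans \<open>L\<close> and \<open>M\<close> serve two uses: \<open>M = L\<close>
  treats monotone images of \<open>L\<close>, and the identity on a Lelek fan \<open>M = Y\<close>
  gives uniqueness up to homeomorphism.\<close>

lemma monotone_image_Lelek_fan_homeomorphic:
  assumes "Lelek_fan L" "Lelek_fan M" "monotone_map M f" "f ` M = Y" "nondegenerate Y"
  shows "\<exists>F G. homeomorphism L Y F G"
proof -
  obtain v \<rho> U where L: "leg_structure L v \<rho> U"
    using monotone_image_Lelek_fan_leg_structure[OF assms(1) monotone_map_id _ Lelek_fan_nondegenerate[OF assms(1)]]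
    by auto
  obtain w \<sigma> V where Y: "leg_structure Y w \<sigma> V"
    using monotone_image_Lelek_fan_leg_structure[OF assms(2-5)] by blast
  show ?thesis by (rule leg_structures_homeomorphic[OF L Y])
qed

theorem mainTheorem11:
  fixes L :: "'a::metric_space set" and Y :: "'b::metric_space set"
  assumes "Lelek_fan L" and "continuum Y" and "nondegenerate Y"
  shows "((\<exists>e r. embedding_into Y L e \<and> retraction L (e ` Y) r \<and> monotone_map L r)
            \<longleftrightarrow> (\<exists>f. f ` L = Y \<and> monotone_map L f))
       \<and> ((\<exists>f. f ` L = Y \<and> monotone_map L f) \<longleftrightarrow> Lelek_fan Y)"
proof -
  have retract_map: "\<exists>f. f ` L = Y \<and> monotone_map L f"
    if e: "embedding_into Y L e" and r: "retraction L (e ` Y) r" "monotone_map L r" for e r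
  proof -
    obtain e' where e': "homeomorphism Y (e ` Y) e e'" using e unfolding embedding_into_def by blast
    have rL: "r ` L = e ` Y" using r(1) by (metis retraction)
    \<comment> \<open>\<open>e'\<close> is injective on the range of \<open>r\<close>, so the fibres
      of \<open>e' \<circ> r\<close> are those of \<open>r\<close>.\<close>
    have inj: "e' a = e' b \<longleftrightarrow> a = b" if "a \<in> r ` L" "b \<in> r ` L" for a b
      using e' that rL by (metis homeomorphism_apply2)
    have "(e' \<circ> r) ` L = Y" unfolding image_comp[symmetric] rL using e' by (rule homeomorphism_image2)
    moreover have "monotone_map L (e' \<circ> r)"
      unfolding monotone_map_def
    proof
      show "continuous_on L (e' \<circ> r)"
        using r(2) e' rL unfolding monotone_map_def by (metis continuous_on_compose homeomorphism_cont2)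
      show "\<forall>z\<in>(e' \<circ> r) ` L. connected {x \<in> L. (e' \<circ> r) x = z}"
      proof
        fix z assume "z \<in> (e' \<circ> r) ` L"
        then obtain a where a: "a \<in> L" "z = e' (r a)" by auto
        then have "{x \<in> L. (e' \<circ> r) x = z} = {x \<in> L. r x = r a}" using inj by auto
        then show "connected {x \<in> L. (e' \<circ> r) x = z}" using r(2) a unfolding monotone_map_def by simp
      qed
    qed
    ultimately show ?thesis by blast
  qed
  have image_Lelek: "Lelek_fan Y" if "f ` L = Y" "monotone_map L f" for f
    using monotone_image_Lelek_fan_homeomorphic[OF assms(1,1) that(2,1) assms(3)]
      Lelek_fan_homeomorphic assms(1) by blast
  have Lelek_retract: "\<exists>e r. embedding_into Y L e \<and> retraction L (e ` Y) r \<and> monotone_map L r"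
    if Y: "Lelek_fan Y"
  proof -
    obtain F G where FG: "homeomorphism L Y F G"
      using monotone_image_Lelek_fan_homeomorphic[OF assms(1) Y monotone_map_id _ assms(3)] by auto
    then have GY: "G ` Y = L" "homeomorphism Y L G F"
      by (auto simp: homeomorphism_image2 intro: homeomorphism_symD)
    then have "embedding_into Y L G" unfolding embedding_into_def by auto
    moreover have "retraction L (G ` Y) (\<lambda>x. x)" using GY by (simp add: retraction_def)
    ultimately show ?thesis using monotone_map_id by blast
  qed
  show ?thesis using retract_map image_Lelek Lelek_retract by blast
qed

end
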